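(* (Frobenius theorem in Banach spaces) Let $E$ be a Banach space, $\Lambda\subset E$ an open set, $\mathcal{F}=\{M(x)\}_{x\in\Lambda}$ a family of subspaces $M(x)\subset E$ (possibly infinite-dimensional), $x_0\in\Lambda$, and $M_0=M(x_0)$. Then $\mathcal{F}$ is $C^1$ integrable at $x_0$ if and only if the following conditions hold: (i) $M_0$ splits in $E$, say $E=M_0\oplus E_*$ (for some closed subspace $E_*$); (ii) there exist a neighborhood $V$ of $P^{E_*}_{M_0}x_0$ in $M_0$ and a $C^1$ map $\psi:V\to E_*$ such that $x+\psi(x)\in J(x_0,E_* )$ for all $x\in V$, and $x\mapsto\alpha(x+\psi(x))$ is continuous in $V$; (iii) $\psi$ satisfies $$\psi'(x)=\alpha(x+\psi(x))\quad\text{for all }x\in V,\qquad \psi(P^{E_*}_{M_0}x_0)=P^{M_0}_{E_*}x_0,$$ where $\psi'(x)$ is the Fréchet derivative of $\psi$ at $x$.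
   Context: Direct sums: $E=A\oplus B$ means that $A,B$ are closed subspaces of $E$ with $A+B=E$ and $A\cap B=\{0\}$; then $P^{B}_{A}$ denotes the bounded projection of $E$ onto $A$ with kernel $B$. A subspace $A$ splits in $E$ if it is closed and $E=A\oplus B$ for some closed $B$. $B(X,Y)$ denotes the bounded linear operators from $X$ to $Y$ with the operator norm. $C^1$ submanifold: a subset $S\subset E$ is a $C^1$ submanifold if for each $p\in S$ there are a subspace $E_0$ splitting in $E$, an open neighborhood $U_0$ of $p$ in $E$, and a $C^1$ diffeomorphism $\varphi:U_0\to\varphi(U_0)$ onto an open subset of $E$, such that $\varphi(S\cap U_0)$ is an open set in $E_0$. Tangency: $S$ is tangent to $M(x)$ at $x\in S$ if $M(x)=\{\dot c(0): c \text{ a } C^1\text{-curve},\ c(t)\in S,\ c(0)=x\}$. Integrability: $\mathcal{F}$ is $C^1$ integrable at $x_0\in\Lambda$ if there is a $C^1$ submanifold $S\subset\Lambda$ of $E$ with $x_0\in S$ which is tangent to $M(x)$ at every $x\in S$. Co-final set and coordinate operator: for a closed subspace $E_*$ with $E=M_0\oplus E_*$, put $J(x_0,E_* )=\{x\in\Lambda: M(x)\oplus E_*=E\}$. For each $x\in J(x_0,E_* )$ there is a unique operator $\alpha(x)\in B(M_0,E_* )$ with $M(x)=\{e+\alpha(x)e: e\in M_0\}$. *)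

theory Defs
  imports "HOL-Analysis.Analysis"
begin

definition direct_sum :: "'a::real_normed_vector set \<Rightarrow> 'a set \<Rightarrow> bool" where
  "direct_sum A B \<longleftrightarrow>
     subspace A \<and> closed A \<and> subspace B \<and> closed B \<and>
     {a + b | a b. a \<in> A \<and> b \<in> B} = UNIV \<and> A \<inter> B = {0}"

definition splits :: "'a::real_normed_vector set \<Rightarrow> bool" where
  "splits A \<longleftrightarrow> (\<exists>B. direct_sum A B)"

text \<open>The projection onto \<^term>\<open>A\<close> with kernel \<^term>\<open>B\<close>; it is meaningful when
  \<^prop>\<open>direct_sum A B\<close> holds in a Banach space.\<close>

definition proj :: "'a::real_normed_vector set \<Rightarrow> 'a set \<Rightarrow> 'a \<Rightarrow>\<^sub>L 'a" where
  "proj A B = (THE P. P o\<^sub>L P = P \<and> range (blinfun_apply P) = A \<and> {z. blinfun_apply P z = 0} = B)"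

text \<open>The subspaces are sets rather than types, so the elements of $B(X,Y)$ are rendered as
  extensional functions on \<^term>\<open>X\<close> (equal to \<^const>\<open>undefined\<close> off \<^term>\<open>X\<close>). Equality in
  $B(X,Y)$ is then equality of functions.\<close>

definition bounded_ops :: "'a::real_normed_vector set \<Rightarrow> 'b::real_normed_vector set \<Rightarrow> ('a \<Rightarrow> 'b) set" where
  "bounded_ops X Y =
     {T \<in> X \<rightarrow>\<^sub>E Y. (\<forall>u\<in>X. \<forall>v\<in>X. T (u + v) = T u + T v) \<and>
                 (\<forall>r. \<forall>u\<in>X. T (r *\<^sub>R u) = r *\<^sub>R T u) \<and>
                 (\<exists>K. \<forall>u\<in>X. norm (T u) \<le> K * norm u)}"

text \<open>The same formula as \<^const>\<open>onorm\<close>, with the supremum over the subspace only.\<close>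

definition onorm_sub :: "'a::real_normed_vector set \<Rightarrow> ('a \<Rightarrow> 'b::real_normed_vector) \<Rightarrow> real" where
  "onorm_sub X T = (SUP u\<in>X. norm (T u) / norm u)"

definition op_continuous_on ::
    "'a::real_normed_vector set \<Rightarrow> 'a set \<Rightarrow> ('a \<Rightarrow> 'a \<Rightarrow> 'b::real_normed_vector) \<Rightarrow> bool" where
  "op_continuous_on V X T \<longleftrightarrow>
     (\<forall>x\<in>V. ((\<lambda>y. onorm_sub X (\<lambda>e. T y e - T x e)) \<longlongrightarrow> 0) (at x within V))"

text \<open>Frechet derivative at \<^term>\<open>x\<close> of a map from \<^term>\<open>V\<close>, an open subset of the subspace
  \<^term>\<open>X\<close>, to the subspace \<^term>\<open>Y\<close>. The derivative is an element of $B(X,Y)$ and not, as for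
  \<^const>\<open>has_derivative\<close>, an operator on the whole ambient space (which would not be
  unique).\<close>

definition has_frechet_derivative_sub ::
    "'a::real_normed_vector set \<Rightarrow> 'b::real_normed_vector set \<Rightarrow> 'a set \<Rightarrow> ('a \<Rightarrow> 'b) \<Rightarrow> ('a \<Rightarrow> 'b) \<Rightarrow> 'a \<Rightarrow> bool" where
  "has_frechet_derivative_sub X Y V f L x \<longleftrightarrow>
     L \<in> bounded_ops X Y \<and>
     ((\<lambda>y. norm (f y - f x - L (y - x)) / norm (y - x)) \<longlongrightarrow> 0) (at x within V)"

definition C1_map_sub ::
    "'a::real_normed_vector set \<Rightarrow> 'b::real_normed_vector set \<Rightarrow> 'a set \<Rightarrow> ('a \<Rightarrow> 'b) \<Rightarrow> bool" where
  "C1_map_sub X Y V f \<longleftrightarrow>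
     f ` V \<subseteq> Y \<and>
     (\<exists>f'. (\<forall>x\<in>V. has_frechet_derivative_sub X Y V f (f' x) x) \<and> op_continuous_on V X f')"

text \<open>Used for open \<^term>\<open>U\<close> only.\<close>

definition C1_map_on :: "'a::real_normed_vector set \<Rightarrow> ('a \<Rightarrow> 'b::real_normed_vector) \<Rightarrow> bool" where
  "C1_map_on U f \<longleftrightarrow>
     (\<exists>f'. (\<forall>x\<in>U. (f has_derivative blinfun_apply (f' x)) (at x)) \<and> continuous_on U f')"

definition C1_diffeomorphism_on :: "'a::real_normed_vector set \<Rightarrow> ('a \<Rightarrow> 'b::real_normed_vector) \<Rightarrow> bool" where
  "C1_diffeomorphism_on U f \<longleftrightarrow>
     open U \<and> open (f ` U) \<and> inj_on f U \<and> C1_map_on U f \<and> C1_map_on (f ` U) (inv_into U f)"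

definition C1_submanifold :: "'a::real_normed_vector set \<Rightarrow> bool" where
  "C1_submanifold S \<longleftrightarrow>
     (\<forall>p\<in>S. \<exists>(E0 :: 'a set) U0 (\<phi> :: 'a \<Rightarrow> 'a).
        splits E0 \<and> open U0 \<and> p \<in> U0 \<and> C1_diffeomorphism_on U0 \<phi> \<and>
        openin (top_of_set E0) (\<phi> ` (S \<inter> U0)))"

definition tangent_to :: "'a::real_normed_vector set \<Rightarrow> 'a set \<Rightarrow> 'a \<Rightarrow> bool" where
  "tangent_to S T x \<longleftrightarrow>
     T = {vector_derivative c (at 0) | c \<epsilon>.
            0 < \<epsilon> \<and> c C1_differentiable_on {-\<epsilon><..<\<epsilon>} \<and>
            (\<forall>t\<in>{-\<epsilon><..<\<epsilon>}. c t \<in> S) \<and> c 0 = x}"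

definition C1_integrable_at ::
    "'a::real_normed_vector set \<Rightarrow> ('a \<Rightarrow> 'a set) \<Rightarrow> 'a \<Rightarrow> bool" where
  "C1_integrable_at \<Lambda> M x0 \<longleftrightarrow>
     (\<exists>S. S \<subseteq> \<Lambda> \<and> C1_submanifold S \<and> x0 \<in> S \<and> (\<forall>x\<in>S. tangent_to S (M x) x))"

definition cofinal_set ::
    "'a::real_normed_vector set \<Rightarrow> ('a \<Rightarrow> 'a set) \<Rightarrow> 'a set \<Rightarrow> 'a set" where
  "cofinal_set \<Lambda> M Es = {x \<in> \<Lambda>. direct_sum (M x) Es}"

text \<open>The operator $\alpha(x)$; it is meaningful when \<^prop>\<open>direct_sum M0 Es\<close> and
  \<^prop>\<open>direct_sum (M x) Es\<close> hold in a Banach space.\<close>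

definition coord_op ::
    "'a::real_normed_vector set \<Rightarrow> 'a set \<Rightarrow> ('a \<Rightarrow> 'a set) \<Rightarrow> 'a \<Rightarrow> 'a \<Rightarrow> 'a" where
  "coord_op M0 Es M x = (THE T. T \<in> bounded_ops M0 Es \<and> M x = {e + T e | e. e \<in> M0})"

text \<open>Uniqueness behind the two definite descriptions.\<close>

lemma proj_eqI:
  fixes P :: "'a::real_normed_vector \<Rightarrow>\<^sub>L 'a"
  assumes "P o\<^sub>L P = P" "range (blinfun_apply P) = A" "{z. blinfun_apply P z = 0} = B"
  shows "proj A B = P"
  unfolding proj_def
proof (rule the_equality)
  show "P o\<^sub>L P = P \<and> range (blinfun_apply P) = A \<and> {z. blinfun_apply P z = 0} = B"
    using assms by blast
next
  fix Q :: "'a \<Rightarrow>\<^sub>L 'a"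
  assume Q: "Q o\<^sub>L Q = Q \<and> range (blinfun_apply Q) = A \<and> {z. blinfun_apply Q z = 0} = B"
  have PP: "P (P z) = P z" and QQ: "Q (Q z) = Q z" for z
    using assms(1) Q by (metis blinfun_apply_blinfun_compose)+
  show "Q = P"
  proof (rule blinfun_eqI)
    fix z
    have "P (z - P z) = 0" using PP by (simp add: blinfun.diff_right)
    then have "z - P z \<in> {z. blinfun_apply Q z = 0}" using assms(3) Q by blast
    then have "Q z = Q (P z)" by (simp add: blinfun.diff_right)
    moreover obtain w where "P z = Q w"
      using assms(2) Q by (metis rangeE rangeI)
    ultimately show "Q z = P z" using QQ by simp
  qed
qed

lemma coord_op_eqI:
  assumes ds: "direct_sum M0 Es"
    and T: "T \<in> bounded_ops M0 Es" "M x = {e + T e | e. e \<in> M0}"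
  shows "coord_op M0 Es M x = T"
  unfolding coord_op_def
proof (rule the_equality)
  show "T \<in> bounded_ops M0 Es \<and> M x = {e + T e | e. e \<in> M0}" using T by blast
next
  fix R assume R: "R \<in> bounded_ops M0 Es \<and> M x = {e + R e | e. e \<in> M0}"
  have mem: "T e \<in> Es" "R e \<in> Es" if "e \<in> M0" for e
    using that T R by (auto simp: bounded_ops_def)
  show "R = T"
  proof (rule PiE_ext)
    show "R \<in> M0 \<rightarrow>\<^sub>E Es" "T \<in> M0 \<rightarrow>\<^sub>E Es" using T R by (auto simp: bounded_ops_def)
    fix e assume e: "e \<in> M0"
    then obtain d where d: "d \<in> M0" "e + R e = d + T d" using T R by blast
    have "e - d = T d - R e" using d(2) by (simp add: algebra_simps)
    moreover have "e - d \<in> M0" "T d - R e \<in> Es"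
      using ds e d mem by (auto simp: direct_sum_def subspace_diff)
    ultimately have "e - d \<in> M0 \<inter> Es" by simp
    then have "e - d = 0" using ds unfolding direct_sum_def by blast
    then have "e = d" by simp
    then show "R e = T e" using d by simp
  qed
qed

end

theory Submission
  imports Defs
begin

text \<open>A chart of a submanifold $S$ with model space $E_0$ identifies the velocities of curves in $S$
  through $x$ with the preimage of $E_0$ under the derivative of the chart.

  Given the graph map $\psi$, the shear $z \mapsto z - \psi(Pz)$, where $P$ is the projection onto
  $M_0$ along $E_*$, is a chart of the graph with model space $M_0$, and the preimage of $M_0$ under its
  derivative at $x + \psi(x)$ is the graph of $\psi'(x) = \alpha(x + \psi(x))$.

  Conversely, a chart $\varphi$ of the integral submanifold at $x_0$ transports a complement of $E_0$ to a
  complement $E_*$ of $M_0$. With $B = \varphi'(x_0)^{-1}$, the map $F z = Pz + (I - P) B \varphi(z)$ has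
  derivative $I$ at $x_0$ and maps $S$ into $M_0$ without changing the component along $M_0$, so its local
  inverse parametrises $S$ as a graph over $M_0$. Boundedness of $P$ is an instance of the open
  mapping theorem.\<close>

section \<open>Projections of direct sums\<close>

lemma direct_sumI_projection:
  fixes P :: "'a::real_normed_vector \<Rightarrow>\<^sub>L 'a"
  assumes "P o\<^sub>L P = P" "range (blinfun_apply P) = A" "{z. blinfun_apply P z = 0} = B"
  shows "direct_sum A B"
proof -
  have PP: "P (P z) = P z" for z
    using assms(1) by (metis blinfun_apply_blinfun_compose)
  \<comment> \<open>Written as the fixed points of \<open>P\<close>, the range becomes the kernel of
    a continuous map, so \<open>A\<close> and \<open>B\<close> are closed by the same
    argument.\<close>
  have A: "A = {z. P z - z = 0}"
    unfolding assms(2)[symmetric] using PP by (auto simp: image_iff) metis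
  have "subspace A" "subspace B"
    unfolding A assms(3)[symmetric] by (auto simp: subspace_def blinfun.bilinear_simps algebra_simps)
  moreover have "closed A" "closed B"
    unfolding A assms(3)[symmetric] by (intro closed_Collect_eq continuous_intros)+
  moreover have "z \<in> {a + b | a b. a \<in> A \<and> b \<in> B}" for z
  proof -
    have "z = P z + (z - P z)" "P z \<in> A" "z - P z \<in> B"
      using PP by (auto simp: A assms(3)[symmetric] blinfun.bilinear_simps)
    then show ?thesis by blast
  qed
  moreover have "A \<inter> B = {0}"
    by (auto simp: A assms(3)[symmetric])
  ultimately show ?thesis
    unfolding direct_sum_def by blast
qed

lemma direct_sum_decompose:
  assumes "direct_sum A B"
  obtains a b where "a \<in> A" "b \<in> B" "z = a + b"
proof -
  have "z \<in> {a + b | a b. a \<in> A \<and> b \<in> B}"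
    using assms unfolding direct_sum_def by blast
  then show ?thesis using that by blast
qed

lemma direct_sum_unique:
  assumes ds: "direct_sum A B" and "a \<in> A" "a' \<in> A" "b \<in> B" "b' \<in> B" "a + b = a' + b'"
  shows "a = a'" "b = b'"
proof -
  have "a - a' = b' - b" using assms(6) by (simp add: algebra_simps)
  moreover have "a - a' \<in> A" "b' - b \<in> B"
    using assms by (auto simp: direct_sum_def subspace_diff)
  ultimately have "a - a' \<in> A \<inter> B" by simp
  then have "a - a' = 0" using ds unfolding direct_sum_def by blast
  then show "a = a'" "b = b'" using assms(6) by auto
qed

text \<open>This recentres a ball: if \<open>c\<close> and \<open>c + z\<close> lie in the closure
  of a set, then \<open>z\<close> is approximated by differences of its points. For sums with a
  bounded component along \<open>A\<close>, taking differences only doubles the bound.\<close>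

lemma closure_diff_approx:
  fixes D :: "'a::real_normed_vector set"
  assumes "u \<in> closure D" "v \<in> closure D" "0 < e"
  obtains x y where "x \<in> D" "y \<in> D" "norm ((u - v) - (x - y)) < e"
proof -
  obtain x y where xy: "x \<in> D" "dist x u < e/2" "y \<in> D" "dist y v < e/2"
    using assms closure_approachable[of u D] closure_approachable[of v D] by (meson half_gt_zero)
  have "norm ((u - v) - (x - y)) = norm ((u - x) + (y - v))" by (simp add: algebra_simps)
  also have "\<dots> \<le> dist x u + dist y v"
    using norm_triangle_ineq[of "u - x" "y - v"] by (simp add: dist_norm norm_minus_commute)
  also have "\<dots> < e" using xy by linarith
  finally show ?thesis using that xy by blast
qed

text \<open>The half of the open mapping theorem that needs Baire: some ball lies in the closure of the
  set of sums $a + b$ with $\|a\|$ bounded. Iterating on the remainder then gives exact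
  decompositions with the same kind of bound.\<close>

lemma direct_sum_approx:
  fixes A :: "'a::banach set"
  assumes ds: "direct_sum A B"
  obtains C where "0 \<le> C"
    "\<And>z. \<exists>a\<in>A. \<exists>b\<in>B. norm a \<le> C * norm z \<and> norm (z - (a + b)) \<le> norm z / 2"
proof -
  have sA: "subspace A" and sB: "subspace B" using ds by (auto simp: direct_sum_def)
  define D where "D n = {a + b | a b. a \<in> A \<and> b \<in> B \<and> norm a \<le> real n}" for n
  have "\<exists>n. interior (closure (D n)) \<noteq> {}"
  proof (rule ccontr)
    assume "\<not> ?thesis"
    then have empty: "interior (closure (D n)) = {}" for n by blast
    have "Met_TC.mtopology interior_of \<Union> (range (\<lambda>n. closure (D n))) = {}"
    proof (rule Met_TC.metric_Baire_category_alt)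
      show "Met_TC.mcomplete TYPE('a)" by (simp only: mcomplete_iff_complete complete_UNIV)
      fix T assume "T \<in> range (\<lambda>n. closure (D n))"
      then obtain n where "T = closure (D n)" by (rule rangeE)
      then show "closedin Met_TC.mtopology T \<and> Met_TC.mtopology interior_of T = {}"
        by (simp add: empty)
    qed simp
    then have "interior (\<Union> (range (\<lambda>n. closure (D n)))) = {}" by simp
    moreover have "\<Union> (range (\<lambda>n. closure (D n))) = UNIV"
    proof -
      have "\<exists>n. z \<in> D n" for z
      proof -
        obtain a b where "a \<in> A" "b \<in> B" "z = a + b" using direct_sum_decompose[OF ds] .
        moreover obtain n where "norm a \<le> real n" using real_arch_simple by blast
        ultimately show ?thesis unfolding D_def by blast
      qed
      then have "\<exists>n. z \<in> closure (D n)" for z using subsetD[OF closure_subset] by metis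
      then show ?thesis by (simp add: set_eq_iff)
    qed
    ultimately show False by simp
  qed
  then obtain n c where "c \<in> interior (closure (D n))" by blast
  then obtain r where r: "0 < r" "ball c r \<subseteq> closure (D n)"
    by (meson mem_interior)
  have approx: "\<exists>a\<in>A. \<exists>b\<in>B. norm a \<le> 2 * real n \<and> norm (z - (a + b)) < e"
    if z: "norm z < r" and e: "0 < e" for z e
  proof -
    have "c + z \<in> closure (D n)" "c \<in> closure (D n)"
      using r z by (auto simp: dist_norm subset_iff)
    then obtain x y where xy: "x \<in> D n" "y \<in> D n" "norm ((c + z - c) - (x - y)) < e"
      using closure_diff_approx e by blast
    then obtain a b a' b' where ab: "a \<in> A" "b \<in> B" "x = a + b" "norm a \<le> real n"
      "a' \<in> A" "b' \<in> B" "y = a' + b'" "norm a' \<le> real n"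
      unfolding D_def by blast
    have "norm (a - a') \<le> 2 * real n"
      using norm_triangle_ineq4[of a a'] ab by linarith
    moreover have "z - ((a - a') + (b - b')) = (c + z - c) - (x - y)"
      using ab by (simp add: algebra_simps)
    then have "norm (z - ((a - a') + (b - b'))) < e" using xy(3) by (simp only:)
    moreover have "a - a' \<in> A" "b - b' \<in> B" using ab sA sB by (auto simp: subspace_diff)
    ultimately show ?thesis by (intro bexI[of _ "a - a'"] bexI[of _ "b - b'"] conjI)
  qed
  show thesis
  proof
    show "0 \<le> 4 * real n / r" using r by simp
    fix z :: 'a
    show "\<exists>a\<in>A. \<exists>b\<in>B. norm a \<le> 4 * real n / r * norm z \<and> norm (z - (a + b)) \<le> norm z / 2"
    proof (cases "z = 0")
      case True
      then show ?thesis using subspace_0[OF sA] subspace_0[OF sB] by (intro bexI[of _ 0]) auto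
    next
      case False
      \<comment> \<open>Scaling \<open>z\<close> to norm \<open>r / 2\<close> puts it inside the
        ball where \<open>approx\<close> applies. Dividing the bound \<open>2 * real n\<close> by
        \<open>t\<close> then produces the constant \<open>4 * real n / r\<close>.\<close>
      define t where "t = r / (2 * norm z)"
      have t: "0 < t" using r False by (simp add: t_def)
      have "norm (t *\<^sub>R z) < r" using r False by (simp add: t_def)
      moreover have "0 < t * (norm z / 2)" using t False by simp
      ultimately obtain a b where ab: "a \<in> A" "b \<in> B" "norm a \<le> 2 * real n"
        "norm (t *\<^sub>R z - (a + b)) < t * (norm z / 2)"
        using approx by meson
      have "norm (a /\<^sub>R t) \<le> 4 * real n / r * norm z"
        using ab(3) t r False by (simp add: t_def field_simps)
      moreover have "t *\<^sub>R z - (a + b) = t *\<^sub>R (z - (a /\<^sub>R t + b /\<^sub>R t))"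
        using t by (simp add: algebra_simps)
      then have "t * norm (z - (a /\<^sub>R t + b /\<^sub>R t)) < t * (norm z / 2)"
        using ab(4) t by simp
      then have "norm (z - (a /\<^sub>R t + b /\<^sub>R t)) \<le> norm z / 2"
        using t by simp
      moreover have "a /\<^sub>R t \<in> A" "b /\<^sub>R t \<in> B" using ab sA sB by (auto simp: subspace_scale)
      ultimately show ?thesis by blast
    qed
  qed
qed

text \<open>Each approximate decomposition halves the remainder, so the summands in \<open>A\<close>
  are dominated by a geometric series of total \<open>2 * C * norm z\<close>. Completeness gives a
  limit, closedness keeps it in \<open>A\<close>, and uniqueness of decompositions identifies it
  with \<open>a\<close>.\<close>

lemma direct_sum_bounded:
  fixes A :: "'a::banach set"
  assumes ds: "direct_sum A B"
  obtains C where "\<And>a b. a \<in> A \<Longrightarrow> b \<in> B \<Longrightarrow> norm a \<le> C * norm (a + b)"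
proof -
  have sub: "subspace A" "subspace B" "closed A" "closed B" using ds by (auto simp: direct_sum_def)
  obtain C where C: "0 \<le> C"
    "\<And>z. \<exists>a\<in>A. \<exists>b\<in>B. norm a \<le> C * norm z \<and> norm (z - (a + b)) \<le> norm z / 2"
    using direct_sum_approx[OF ds] by blast
  then obtain f g where fg: "\<And>z. f z \<in> A" "\<And>z. g z \<in> B" "\<And>z. norm (f z) \<le> C * norm z"
    "\<And>z. norm (z - (f z + g z)) \<le> norm z / 2"
    by metis
  show thesis
  proof
    fix a b assume a: "a \<in> A" and b: "b \<in> B"
    define z where "z = a + b"
    define s where "s k = ((\<lambda>y. y - (f y + g y)) ^^ k) z" for k
    have s0: "s 0 = z" and s_Suc: "s (Suc k) = s k - (f (s k) + g (s k))" for k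
      by (simp_all add: s_def)
    have s_le: "norm (s k) \<le> norm z * (1/2) ^ k" for k
    proof (induction k)
      case (Suc k)
      then show ?case using fg(4)[of "s k"] by (simp add: s_Suc)
    qed (simp add: s0)
    have f_le: "norm (f (s k)) \<le> C * norm z * (1/2) ^ k" for k
      using fg(3)[of "s k"] mult_left_mono[OF s_le C(1), of k] by (simp add: mult.assoc)
    have geo: "(\<lambda>k. C * norm z * (1/2) ^ k) sums (C * norm z * 2)"
      using sums_mult[OF geometric_sums[of "1/2::real"], of "C * norm z"] by simp
    have summ: "summable (\<lambda>k. f (s k))"
      by (rule summable_comparison_test'[OF sums_summable[OF geo]]) (rule f_le)
    define a' where "a' = (\<Sum>k. f (s k))"
    have lim_a: "(\<lambda>m. \<Sum>k<m. f (s k)) \<longlonglongrightarrow> a'"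
      unfolding a'_def by (rule summable_LIMSEQ[OF summ])
    \<comment> \<open>No bound on the summands in \<open>B\<close> is available. Their partial sums
      converge because the two partial sums together equal \<open>z - s m\<close>, and the remainder
      tends to zero.\<close>
    have telescope: "(\<Sum>k<m. f (s k)) + (\<Sum>k<m. g (s k)) = z - s m" for m
      by (induction m) (auto simp: s0 s_Suc algebra_simps)
    have "s \<longlonglongrightarrow> 0"
    proof (rule Lim_null_comparison)
      show "\<forall>\<^sub>F k in sequentially. norm (s k) \<le> norm z * (1/2) ^ k" using s_le by simp
      show "(\<lambda>k. norm z * (1/2) ^ k) \<longlonglongrightarrow> 0"
        by (intro tendsto_mult_right_zero LIMSEQ_power_zero) simp
    qed
    then have "(\<lambda>m. (z - s m) - (\<Sum>k<m. f (s k))) \<longlonglongrightarrow> (z - 0) - a'"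
      by (intro tendsto_intros lim_a)
    then have lim_b: "(\<lambda>m. \<Sum>k<m. g (s k)) \<longlonglongrightarrow> z - a'"
      by (simp flip: telescope)
    have "a' \<in> A"
      using closed_sequentially[OF sub(3) _ lim_a] fg(1) sub(1) by (auto intro: subspace_sum)
    moreover have "z - a' \<in> B"
      using closed_sequentially[OF sub(4) _ lim_b] fg(2) sub(2) by (auto intro: subspace_sum)
    moreover have "a + b = a' + (z - a')" by (simp add: z_def)
    ultimately have "a = a'" by (rule direct_sum_unique(1)[OF ds a _ b])
    moreover have "norm a' \<le> C * norm z * 2"
      unfolding a'_def using norm_suminf_le[OF f_le sums_summable[OF geo]] sums_unique[OF geo]
      by simp
    ultimately show "norm a \<le> (C * 2) * norm (a + b)" by (simp add: z_def ac_simps)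
  qed
qed

text \<open>Uniqueness of decompositions makes the component along \<open>A\<close> linear, and
  \<open>direct_sum_bounded\<close> makes it bounded.\<close>

lemma direct_sum_projection:
  fixes A :: "'a::banach set"
  assumes ds: "direct_sum A B"
  obtains P :: "'a \<Rightarrow>\<^sub>L 'a"
  where "P o\<^sub>L P = P" "range (blinfun_apply P) = A" "{z. blinfun_apply P z = 0} = B"
proof -
  have sub: "subspace A" "subspace B" using ds by (auto simp: direct_sum_def)
  obtain C where C: "\<And>a b. a \<in> A \<Longrightarrow> b \<in> B \<Longrightarrow> norm a \<le> C * norm (a + b)"
    using direct_sum_bounded[OF ds] by blast
  have "\<exists>a. a \<in> A \<and> z - a \<in> B" for z
    using direct_sum_decompose[OF ds, of z] by (metis add_diff_cancel_left')
  then obtain p where p: "\<And>z. p z \<in> A" "\<And>z. z - p z \<in> B" by metis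
  have p_eq: "p z = a" if "a \<in> A" "z - a \<in> B" for z a
    using direct_sum_unique(1)[OF ds p(1)[of z] that(1) p(2)[of z] that(2)] by simp
  have lin: "bounded_linear p"
  proof (rule bounded_linear_intro)
    show "p (x + y) = p x + p y" for x y
      using subspace_add[OF sub(1) p(1)[of x] p(1)[of y]] subspace_add[OF sub(2) p(2)[of x] p(2)[of y]]
      by (intro p_eq) (auto simp: algebra_simps)
    show "p (r *\<^sub>R x) = r *\<^sub>R p x" for r x
      using subspace_scale[OF sub(1) p(1)[of x], of r] subspace_scale[OF sub(2) p(2)[of x], of r]
      by (intro p_eq) (auto simp: algebra_simps)
    show "norm (p x) \<le> norm x * C" for x
      using C[OF p(1) p(2), of x x] by (simp add: mult.commute)
  qed
  define P where "P = Blinfun p"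
  have P: "blinfun_apply P = p" unfolding P_def using lin by (rule bounded_linear_Blinfun_apply)
  have fix_A: "p a = a" if "a \<in> A" for a using that sub by (intro p_eq) (auto simp: subspace_0)
  show thesis
  proof
    show "P o\<^sub>L P = P" by (rule blinfun_eqI) (simp add: P fix_A p)
    show "range (blinfun_apply P) = A" unfolding P using fix_A p(1) by (auto simp: image_iff) metis
    show "{z. blinfun_apply P z = 0} = B"
      
    proof safe
      fix z assume "P z = 0"
      then show "z \<in> B" using p(2)[of z] by (simp add: P)
    next
      fix z assume "z \<in> B"
      then show "P z = 0" unfolding P by (intro p_eq subspace_0 sub) simp
    qed
  qed
qed

section \<open>The inverse function theorem in Banach spaces\<close>

text \<open>A solution of \<open>f x = w\<close> is a fixed point of \<open>x - f x + w\<close>, a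
  contraction with factor 1/2 because \<open>f\<close> differs from the identity by a map with
  Lipschitz constant 1/2. Half of the radius absorbs the contraction, the other half the distance
  from \<open>w\<close> to \<open>f z\<close>, so the ball is mapped into itself.\<close>

lemma local_surjectivity:
  fixes f :: "'a::banach \<Rightarrow> 'a"
  assumes near: "\<And>x y. x \<in> cball z s \<Longrightarrow> y \<in> cball z s \<Longrightarrow> norm ((f x - f y) - (x - y)) \<le> norm (x - y) / 2"
    and "0 \<le> s" "norm (w - f z) \<le> s / 2"
  shows "\<exists>x\<in>cball z s. f x = w"
proof -
  let ?h = "\<lambda>x. x - f x + w"
  have "\<exists>!x. x \<in> cball z s \<and> ?h x = x"
  proof (rule Banach_fix)
    show "complete (cball z s)" by (simp add: complete_eq_closed)
    show "cball z s \<noteq> {}" using assms by simp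
    show "?h ` cball z s \<subseteq> cball z s"
    proof clarsimp
      fix x assume x: "dist z x \<le> s"
      have "norm (x - f x + w - z) = norm (((x - z) - (f x - f z)) + (w - f z))"
        by (simp add: algebra_simps)
      also have "\<dots> \<le> norm ((f x - f z) - (x - z)) + norm (w - f z)"
        using norm_triangle_ineq[of "(x - z) - (f x - f z)" "w - f z"] by (simp add: norm_minus_commute)
      also have "\<dots> \<le> s / 2 + s / 2"
        using near[of x z] assms(2,3) x by (simp add: dist_norm norm_minus_commute)
      finally show "dist z (x - f x + w) \<le> s" by (simp add: dist_norm norm_minus_commute)
    qed
    show "dist (?h x) (?h y) \<le> 1/2 * dist x y" if "x \<in> cball z s" "y \<in> cball z s" for x y
    proof -
      have "dist (?h x) (?h y) = norm (- ((f x - f y) - (x - y)))"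
        by (simp add: dist_norm algebra_simps)
      then show ?thesis using near[OF that] by (simp only: norm_minus_cancel dist_norm)
    qed
  qed auto
  then obtain x where "x \<in> cball z s" "x - f x + w = x" by blast
  then show ?thesis by (intro bexI[of _ x]) (simp_all add: algebra_simps)
qed

text \<open>Surjectivity is the linear case of \<open>local_surjectivity\<close>, on the ball about
  0 of radius \<open>2 * norm w\<close>. The lower bound \<open>low\<close> yields both injectivity
  and the norm bound 2 for the inverse.\<close>

lemma blinfun_inverse_near_id:
  fixes T :: "'a::banach \<Rightarrow>\<^sub>L 'a"
  assumes T: "norm (T - id_blinfun) \<le> 1/2"
  obtains S where "T o\<^sub>L S = id_blinfun" "S o\<^sub>L T = id_blinfun" "norm S \<le> 2"
proof -
  have near: "norm (T x - x) \<le> norm x / 2" for x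
    using order_trans[OF norm_blinfun[of "T - id_blinfun" x] mult_right_mono[OF T norm_ge_zero[of x]]]
    by (simp add: blinfun.bilinear_simps)
  have low: "norm x \<le> norm (T x) * 2" for x
    using norm_triangle_sub[of x "T x"] near[of x] norm_minus_commute[of x "T x"] by linarith
  have "\<exists>x. T x = w" for w
  proof -
    have "norm ((T x - T y) - (x - y)) \<le> norm (x - y) / 2" for x y
      using near[of "x - y"] by (simp add: blinfun.bilinear_simps)
    then show ?thesis using local_surjectivity[of 0 "2 * norm w" "blinfun_apply T" w] by auto
  qed
  then obtain s where s: "\<And>w. T (s w) = w" by metis
  have inj: "x = y" if "T x = T y" for x y
    using low[of "x - y"] that by (simp add: blinfun.bilinear_simps)
  have s_le: "norm (s x) \<le> 2 * norm x" for x
    using low[of "s x"] by (simp add: s mult.commute)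
  have s_left: "s (T x) = x" for x
    by (rule inj) (rule s)
  have lin: "bounded_linear s"
  proof (rule bounded_linear_intro)
    show "norm (s x) \<le> norm x * 2" for x using s_le[of x] by (simp add: mult.commute)
    show "s (x + y) = s x + s y" "s (r *\<^sub>R x) = r *\<^sub>R s x" for x y r
      by (rule inj, simp add: s blinfun.bilinear_simps)+
  qed
  note S = bounded_linear_Blinfun_apply[OF lin]
  show thesis
  proof
    show "T o\<^sub>L Blinfun s = id_blinfun" by (rule blinfun_eqI) (simp add: S s)
    show "Blinfun s o\<^sub>L T = id_blinfun" by (rule blinfun_eqI) (simp add: S s_left)
    show "norm (Blinfun s) \<le> 2"
      by (rule norm_blinfun_bound) (simp_all add: S s_le)
  qed
qed

text \<open>The inverse function theorem, normalised so that the derivative at the base point is the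
  identity. The two operator identities are part of the conclusion because tangent spaces are later
  computed by passing back and forth between \<open>F'\<close> and \<open>G'\<close>.\<close>

lemma local_inverse_near_identity:
  fixes F :: "'a::banach \<Rightarrow> 'a" and F' :: "'a \<Rightarrow> 'a \<Rightarrow>\<^sub>L 'a"
  assumes U: "open U" "x0 \<in> U"
    and derF: "\<And>x. x \<in> U \<Longrightarrow> (F has_derivative blinfun_apply (F' x)) (at x)"
    and contF': "continuous_on U F'"
    and F'x0: "F' x0 = id_blinfun"
  obtains N G G' where "open N" "x0 \<in> N" "N \<subseteq> U" "open (F ` N)"
    "\<And>x. x \<in> N \<Longrightarrow> G (F x) = x"
    "\<And>y. y \<in> F ` N \<Longrightarrow> (G has_derivative blinfun_apply (G' y)) (at y)"
    "continuous_on (F ` N) G'"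
    "\<And>x. x \<in> N \<Longrightarrow> F' x o\<^sub>L G' (F x) = id_blinfun"
    "\<And>x. x \<in> N \<Longrightarrow> G' (F x) o\<^sub>L F' x = id_blinfun"
proof -
  have "isCont F' x0" using contF' U by (simp add: continuous_on_eq_continuous_at)
  then obtain d where d: "0 < d" "\<And>x. dist x x0 < d \<Longrightarrow> dist (F' x) (F' x0) < 1/2"
    unfolding continuous_at_eps_delta by (metis half_gt_zero zero_less_one)
  obtain e where e: "0 < e" "ball x0 e \<subseteq> U" using U by (meson openE)
  define N where "N = ball x0 (min d e)"
  have N: "open N" "x0 \<in> N" "N \<subseteq> U" "convex N"
    using d(1) e by (auto simp: N_def)
  have F'_near: "norm (F' x - id_blinfun) \<le> 1/2" if "x \<in> N" for x
    using d(2)[of x] that F'x0 by (simp add: N_def dist_commute dist_norm norm_minus_commute)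
  \<comment> \<open>This is the mean value inequality for \<open>F x - x\<close> on the ball
    \<open>N\<close>, where the derivative of this difference has norm at most 1/2.\<close>
  have near: "norm ((F x - F y) - (x - y)) \<le> norm (x - y) / 2" if "x \<in> N" "y \<in> N" for x y
  proof -
    have "((\<lambda>x. F x - x) has_derivative blinfun_apply (F' z - id_blinfun)) (at z within N)"
      if "z \<in> N" for z
      using has_derivative_diff[OF has_derivative_at_withinI[OF derF] has_derivative_ident] that N(3)
      by (auto simp: blinfun.bilinear_simps minus_blinfun.rep_eq)
    moreover have "onorm (blinfun_apply (F' z - id_blinfun)) \<le> 1/2" if "z \<in> N" for z
      using F'_near[OF that] by (simp add: norm_blinfun.rep_eq)
    ultimately have "norm ((F x - x) - (F y - y)) \<le> 1/2 * norm (x - y)"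
      by (rule differentiable_bound[OF N(4), of "\<lambda>x. F x - x"]) (use that in auto)
    then show ?thesis by (simp add: algebra_simps)
  qed
  have expand: "norm (x - y) \<le> 2 * norm (F x - F y)" if "x \<in> N" "y \<in> N" for x y
    using near[OF that] norm_triangle_sub[of "x - y" "F x - F y"] norm_minus_commute[of "x - y" "F x - F y"]
    by linarith
  have inj: "inj_on F N"
    by (rule inj_onI) (use expand in fastforce)
  define G where "G = inv_into N F"
  have GF: "G (F x) = x" if "x \<in> N" for x using inj that by (simp add: G_def)
  have "open (F ` N)"
  proof (rule openI)
    fix w assume "w \<in> F ` N"
    then obtain z where z: "z \<in> N" "w = F z" by blast
    then obtain s where s: "0 < s" "cball z s \<subseteq> N" using N(1) by (meson open_contains_cball)
    have "ball w (s/2) \<subseteq> F ` N"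
    proof
      fix v assume "v \<in> ball w (s/2)"
      then have "norm (v - F z) \<le> s/2" using z by (simp add: dist_norm norm_minus_commute)
      then have "\<exists>x\<in>cball z s. F x = v"
        using s by (intro local_surjectivity near) auto
      then show "v \<in> F ` N" using s by blast
    qed
    then show "\<exists>T>0. ball w T \<subseteq> F ` N" using s by (intro exI[of _ "s/2"]) simp
  qed
  \<comment> \<open>Continuity of \<open>G'\<close> reduces to continuity of operator inversion. On
    \<open>I\<close> every operator has an inverse of norm at most 2, so inversion is Lipschitz
    there.\<close>
  define I where "I = {T :: 'a \<Rightarrow>\<^sub>L 'a. norm (T - id_blinfun) \<le> 1/2}"
  have "\<exists>S. T o\<^sub>L S = id_blinfun \<and> S o\<^sub>L T = id_blinfun \<and> norm S \<le> 2" if "T \<in> I" for T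
    using blinfun_inverse_near_id[of T] that unfolding I_def by blast
  then obtain R where R: "\<And>T. T \<in> I \<Longrightarrow> T o\<^sub>L R T = id_blinfun" "\<And>T. T \<in> I \<Longrightarrow> R T o\<^sub>L T = id_blinfun"
    "\<And>T. T \<in> I \<Longrightarrow> norm (R T) \<le> 2"
    by metis
  have R_lip: "dist (R S) (R T) \<le> 4 * dist S T" if "S \<in> I" "T \<in> I" for S T
  proof -
    have 1: "S (R S z) = z" "R T (T z) = z" for z
      using R[OF that(1)] R[OF that(2)]
      by (metis blinfun_apply_blinfun_compose blinfun_apply_id_blinfun id_apply)+
    \<comment> \<open>This is the resolvent identity; the two inverses each contribute a factor 2,
      hence the Lipschitz constant 4.\<close>
    have "R S - R T = - (R T o\<^sub>L (S - T) o\<^sub>L R S)"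
      by (rule blinfun_eqI) (simp add: blinfun.bilinear_simps 1)
    then have "norm (R S - R T) \<le> norm (R T o\<^sub>L (S - T)) * norm (R S)"
      using norm_blinfun_compose[of "R T o\<^sub>L (S - T)" "R S"] by (simp only: norm_minus_cancel)
    also have "\<dots> \<le> (norm (R T) * norm (S - T)) * norm (R S)"
      by (intro mult_right_mono norm_blinfun_compose) simp
    also have "\<dots> \<le> (2 * norm (S - T)) * 2"
      using R(3)[OF that(1)] R(3)[OF that(2)] by (intro mult_mono) auto
    finally show ?thesis by (simp add: dist_norm)
  qed
  have contR: "continuous_on I R"
    using R_lip by (intro lipschitz_on_continuous_on[of 4] lipschitz_onI) auto
  have contG: "continuous_on (F ` N) G"
    using expand by (intro lipschitz_on_continuous_on[of 2] lipschitz_onI) (auto simp: GF dist_norm)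
  define G' where "G' y = R (F' (G y))" for y
  have F'I: "F' x \<in> I" if "x \<in> N" for x using F'_near[OF that] by (simp add: I_def)
  show thesis
  proof
    show "open N" "x0 \<in> N" "N \<subseteq> U" "open (F ` N)" by fact+
    show "G (F x) = x" if "x \<in> N" for x using GF that .
    show right: "F' x o\<^sub>L G' (F x) = id_blinfun" if "x \<in> N" for x
      unfolding G'_def GF[OF that] by (rule R(1)[OF F'I[OF that]])
    show left: "G' (F x) o\<^sub>L F' x = id_blinfun" if "x \<in> N" for x
      unfolding G'_def GF[OF that] by (rule R(2)[OF F'I[OF that]])
    show "continuous_on (F ` N) G'"
      unfolding G'_def
      by (intro continuous_on_compose2[OF contR] continuous_on_compose2[OF continuous_on_subset[OF contF' N(3)] contG])
        (auto simp: GF F'I)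
    show "(G has_derivative blinfun_apply (G' y)) (at y)" if y: "y \<in> F ` N" for y
    proof -
      obtain x where x: "x \<in> N" "y = F x" using y by blast
      show ?thesis
      proof (rule has_derivative_inverse_basic)
        show "(F has_derivative blinfun_apply (F' x)) (at (G y))" using derF x N(3) GF by auto
        show "blinfun_apply (G' y) \<circ> blinfun_apply (F' x) = id"
          using left[OF x(1)] unfolding x(2)
          by (simp add: fun_eq_iff flip: blinfun_compose.rep_eq)
        show "isCont G y" using contG \<open>open (F ` N)\<close> y continuous_on_eq_continuous_at by blast
        show "F (G z) = z" if "z \<in> F ` N" for z using that GF by auto
      qed (use \<open>open (F ` N)\<close> y blinfun.bounded_linear_right in auto)
    qed
  qed
qed

text \<open>An explicit left inverse \<open>g\<close> may replace \<open>inv_into U f\<close>: the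
  two agree on the open image, so they have the same derivatives there.\<close>

lemma C1_diffeomorphism_onI:
  fixes f :: "'a::real_normed_vector \<Rightarrow> 'b::real_normed_vector"
  assumes "open U" "open (f ` U)" and gf: "\<And>x. x \<in> U \<Longrightarrow> g (f x) = x"
    and f: "\<And>x. x \<in> U \<Longrightarrow> (f has_derivative blinfun_apply (f' x)) (at x)" "continuous_on U f'"
    and g: "\<And>y. y \<in> f ` U \<Longrightarrow> (g has_derivative blinfun_apply (g' y)) (at y)" "continuous_on (f ` U) g'"
  shows "C1_diffeomorphism_on U f"
proof -
  have inj: "inj_on f U" using gf by (metis inj_onI)
  have "(inv_into U f has_derivative blinfun_apply (g' y)) (at y)" if "y \<in> f ` U" for y
    using g(1)[OF that] assms(2) that
    by (rule has_derivative_transform_within_open) (auto simp: gf inj)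
  then show ?thesis
    unfolding C1_diffeomorphism_on_def C1_map_on_def using assms inj by blast
qed

text \<open>Both compositions of the map with its inverse are the identity on open sets. The chain
  rule and uniqueness of derivatives therefore make the two derivatives inverse to each
  other.\<close>

lemma C1_diffeomorphism_onE:
  fixes f :: "'a::real_normed_vector \<Rightarrow> 'b::real_normed_vector"
  assumes "C1_diffeomorphism_on U f"
  obtains f' g g' where "open U" "open (f ` U)" "\<And>x. x \<in> U \<Longrightarrow> g (f x) = x"
    "\<And>x. x \<in> U \<Longrightarrow> (f has_derivative blinfun_apply (f' x)) (at x)" "continuous_on U f'"
    "\<And>y. y \<in> f ` U \<Longrightarrow> (g has_derivative blinfun_apply (g' y)) (at y)" "continuous_on (f ` U) g'"
    "\<And>x. x \<in> U \<Longrightarrow> g' (f x) o\<^sub>L f' x = id_blinfun"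
    "\<And>x. x \<in> U \<Longrightarrow> f' x o\<^sub>L g' (f x) = id_blinfun"
proof -
  obtain f' g' where opn: "open U" "open (f ` U)" and inj: "inj_on f U"
    and f: "\<And>x. x \<in> U \<Longrightarrow> (f has_derivative blinfun_apply (f' x)) (at x)" "continuous_on U f'"
    and g: "\<And>y. y \<in> f ` U \<Longrightarrow> (inv_into U f has_derivative blinfun_apply (g' y)) (at y)"
      "continuous_on (f ` U) g'"
    using assms unfolding C1_diffeomorphism_on_def C1_map_on_def by blast
  have left: "g' (f x) o\<^sub>L f' x = id_blinfun" if x: "x \<in> U" for x
  proof -
    have "(inv_into U f \<circ> f has_derivative blinfun_apply (g' (f x)) \<circ> blinfun_apply (f' x)) (at x)"
      using f(1) g(1) x by (intro diff_chain_at) auto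
    moreover have "(inv_into U f \<circ> f has_derivative id) (at x)"
      using has_derivative_id opn(1) x
      by (rule has_derivative_transform_within_open) (simp add: inj)
    ultimately have "blinfun_apply (g' (f x)) \<circ> blinfun_apply (f' x) = id"
      by (rule has_derivative_unique)
    then show ?thesis by (intro blinfun_eqI) (simp add: fun_eq_iff)
  qed
  have right: "f' x o\<^sub>L g' (f x) = id_blinfun" if x: "x \<in> U" for x
  proof -
    have "(f \<circ> inv_into U f has_derivative blinfun_apply (f' x) \<circ> blinfun_apply (g' (f x))) (at (f x))"
      using f(1) g(1) x inj by (intro diff_chain_at) auto
    moreover have "(f \<circ> inv_into U f has_derivative id) (at (f x))"
      using has_derivative_id opn(2)
      by (rule has_derivative_transform_within_open) (use x in \<open>auto simp: f_inv_into_f\<close>)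
    ultimately have "blinfun_apply (f' x) \<circ> blinfun_apply (g' (f x)) = id"
      by (rule has_derivative_unique)
    then show ?thesis by (intro blinfun_eqI) (simp add: fun_eq_iff)
  qed
  show thesis
    by (rule that[of "inv_into U f" f' g']) (use opn inj f g left right in auto)
qed

section \<open>Tangent vectors in a chart\<close>

text \<open>Near \<open>t\<close> the difference quotients lie in \<open>E\<close>, and closedness
  keeps their limit there. Membership of \<open>c t\<close> is a separate assumption because the
  filter \<open>at t\<close> excludes the point \<open>t\<close>.\<close>

lemma has_vector_derivative_in_closed_subspace:
  fixes c :: "real \<Rightarrow> 'a::real_normed_vector"
  assumes c: "(c has_vector_derivative v) (at t)" and E: "subspace E" "closed E"
    and "eventually (\<lambda>s. c s \<in> E) (at t)" "c t \<in> E"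
  shows "v \<in> E"
proof (rule Lim_in_closed_set)
  show "closed E" by fact
  show "eventually (\<lambda>s. (c s - c t) /\<^sub>R (s - t) \<in> E) (at t)"
    using assms(4) by eventually_elim (use E assms(5) in \<open>auto intro: subspace_scale subspace_diff\<close>)
  show "((\<lambda>s. (c s - c t) /\<^sub>R (s - t)) \<longlongrightarrow> v) (at t)"
  proof -
    have "((\<lambda>s. norm (c s - c t - (s - t) *\<^sub>R v) / norm (s - t)) \<longlongrightarrow> 0) (at t)"
      using c by (simp add: has_vector_derivative_def has_derivative_iff_norm)
    moreover have "norm (c s - c t - (s - t) *\<^sub>R v) / norm (s - t) = norm ((c s - c t) /\<^sub>R (s - t) - v)"
      if "s \<noteq> t" for s
    proof -
      have "(c s - c t) /\<^sub>R (s - t) - v = (c s - c t - (s - t) *\<^sub>R v) /\<^sub>R (s - t)"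
        using that by (simp add: scaleR_diff_right)
      then show ?thesis by (simp add: divide_inverse_commute)
    qed
    then have "eventually (\<lambda>s. norm (c s - c t - (s - t) *\<^sub>R v) / norm (s - t)
        = norm ((c s - c t) /\<^sub>R (s - t) - v)) (at t)"
      by (auto simp: eventually_at_filter)
    ultimately have "((\<lambda>s. norm ((c s - c t) /\<^sub>R (s - t) - v)) \<longlongrightarrow> 0) (at t)"
      by (rule Lim_transform_eventually)
    then show ?thesis by (simp add: tendsto_norm_zero_iff LIM_zero_iff)
  qed
qed simp

text \<open>A curve in \<open>S\<close> is carried by the chart to a curve that stays in
  \<open>E\<close> near time 0, so \<open>f'\<close> sends its velocity into \<open>E\<close>.
  Conversely, if \<open>f' u\<close> is in \<open>E\<close>, the straight line through
  \<open>f x\<close> with direction \<open>f' u\<close> pulls back to a curve in \<open>S\<close>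
  with velocity \<open>u\<close>.\<close>

lemma tangent_to_chart:
  assumes "C1_diffeomorphism_on U f" and E: "subspace E" "closed E"
    and op: "openin (top_of_set E) (f ` (S \<inter> U))" and x: "x \<in> S" "x \<in> U"
    and f': "(f has_derivative f') (at x)"
  shows "tangent_to S {u. f' u \<in> E} x"
proof -
  obtain D g g' where U: "open U" "open (f ` U)" and gf: "\<And>x. x \<in> U \<Longrightarrow> g (f x) = x"
    and "\<And>x. x \<in> U \<Longrightarrow> (f has_derivative blinfun_apply (D x)) (at x)"
    and g: "\<And>y. y \<in> f ` U \<Longrightarrow> (g has_derivative blinfun_apply (g' y)) (at y)" "continuous_on (f ` U) g'"
    and left: "\<And>x. x \<in> U \<Longrightarrow> g' (f x) o\<^sub>L D x = id_blinfun"
    using assms(1) by (rule C1_diffeomorphism_onE) blast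
  then have f'_eq: "f' = blinfun_apply (D x)" using f' x(2) has_derivative_unique by blast
  have g'f': "g' (f x) (f' u) = u" for u
    using left[OF x(2)] unfolding f'_eq
    by (metis blinfun_apply_blinfun_compose blinfun_apply_id_blinfun id_apply)
  have fS: "f z \<in> E" if "z \<in> S" "z \<in> U" for z using op that openin_imp_subset by blast
  have "f' (vector_derivative c (at 0)) \<in> E"
    if \<epsilon>: "0 < \<epsilon>" and c: "c C1_differentiable_on {-\<epsilon><..<\<epsilon>}" "\<And>t. t \<in> {-\<epsilon><..<\<epsilon>} \<Longrightarrow> c t \<in> S" "c 0 = x"
    for c and \<epsilon> :: real
  proof -
    have dc: "(c has_vector_derivative vector_derivative c (at 0)) (at 0)"
      using c(1) \<epsilon> by (simp add: C1_differentiable_on_eq vector_derivative_works)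
    then have dfc: "(f \<circ> c has_vector_derivative f' (vector_derivative c (at 0))) (at 0)"
      using f' unfolding c(3)[symmetric] by (rule vector_derivative_diff_chain_within[OF _ has_derivative_at_withinI])
    have "eventually (\<lambda>t. c t \<in> U) (at 0)"
      using has_vector_derivative_continuous[OF dc] U(1) x(2) c(3)
      unfolding continuous_at by (metis topological_tendstoD)
    moreover have "eventually (\<lambda>t. t \<in> {-\<epsilon><..<\<epsilon>}) (at 0)"
      using \<epsilon> by (intro eventually_at_in_open') auto
    ultimately have "eventually (\<lambda>t. (f \<circ> c) t \<in> E) (at 0)"
      by eventually_elim (use c fS in auto)
    then show ?thesis
      using has_vector_derivative_in_closed_subspace[OF dfc E] fS x c(3) by simp
  qed
  moreover have "\<exists>c \<epsilon>. u = vector_derivative c (at 0) \<and> 0 < \<epsilon> \<and> c C1_differentiable_on {-\<epsilon><..<\<epsilon>} \<and>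
      (\<forall>t\<in>{-\<epsilon><..<\<epsilon>}. c t \<in> S) \<and> c 0 = x" if u: "f' u \<in> E" for u
  proof -
    define l where "l t = f x + t *\<^sub>R f' u" for t
    define c where "c t = g (l t)" for t
    obtain W where W: "open W" "f ` (S \<inter> U) = E \<inter> W"
      using op by (auto simp: openin_open)
    have "open (l -` (W \<inter> f ` U))"
      using W(1) U(2) unfolding l_def by (intro open_vimage continuous_intros) auto
    moreover have "0 \<in> l -` (W \<inter> f ` U)" using W x by (auto simp: l_def)
    ultimately obtain \<epsilon> where \<epsilon>: "0 < \<epsilon>" "ball 0 \<epsilon> \<subseteq> l -` (W \<inter> f ` U)" by (meson openE)
    then have lt: "l t \<in> W" "l t \<in> f ` U" if "t \<in> {-\<epsilon><..<\<epsilon>}" for t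
      using that by (auto simp: subset_iff dist_real_def)
    have dc: "(c has_vector_derivative g' (l t) (f' u)) (at t)" if "t \<in> {-\<epsilon><..<\<epsilon>}" for t
    proof -
      have "(l has_vector_derivative f' u) (at t)"
        unfolding l_def by (auto intro!: derivative_eq_intros)
      then have "(g \<circ> l has_vector_derivative g' (l t) (f' u)) (at t)"
        using g(1)[OF lt(2)[OF that]] by (rule vector_derivative_diff_chain_within[OF _ has_derivative_at_withinI])
      then show ?thesis by (simp add: c_def[abs_def] comp_def)
    qed
    have "continuous_on {-\<epsilon><..<\<epsilon>} (\<lambda>t. g' (l t) (f' u))"
      using lt(2) unfolding l_def
      by (intro continuous_intros continuous_on_compose2[OF g(2)]) (auto simp: l_def)
    then have "c C1_differentiable_on {-\<epsilon><..<\<epsilon>}"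
      unfolding C1_differentiable_on_def by (intro exI[of _ "\<lambda>t. g' (l t) (f' u)"]) (simp add: dc)
    moreover have "u = vector_derivative c (at 0)"
    proof -
      have "l 0 = f x" by (simp add: l_def)
      then have "(c has_vector_derivative u) (at 0)" using dc[of 0] \<epsilon>(1) by (simp add: g'f')
      then show ?thesis by (simp add: vector_derivative_at)
    qed
    moreover have "c t \<in> S" if "t \<in> {-\<epsilon><..<\<epsilon>}" for t
    proof -
      have "l t \<in> E" using E(1) u fS[OF x] by (simp add: l_def subspace_add subspace_scale)
      then have "l t \<in> f ` (S \<inter> U)" using W lt(1)[OF that] by blast
      then show ?thesis using gf by (auto simp: c_def)
    qed
    moreover have "c 0 = x" using gf x by (simp add: c_def l_def)
    ultimately show ?thesis using \<epsilon>(1) by blast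
  qed
  ultimately show ?thesis unfolding tangent_to_def by blast
qed

section \<open>Calculus on a complemented subspace\<close>

lemma bounded_opsD:
  assumes "T \<in> bounded_ops X Y" "u \<in> X"
  shows "T u \<in> Y" "v \<in> X \<Longrightarrow> T (u + v) = T u + T v" "T (r *\<^sub>R u) = r *\<^sub>R T u"
  using assms by (auto simp: bounded_ops_def)

lemma bounded_ops_bound:
  assumes "T \<in> bounded_ops X Y"
  obtains K where "\<And>u. u \<in> X \<Longrightarrow> norm (T u) \<le> K * norm u"
proof -
  have "\<exists>K. \<forall>u\<in>X. norm (T u) \<le> K * norm u" using assms unfolding bounded_ops_def by simp
  then obtain K where "\<forall>u\<in>X. norm (T u) \<le> K * norm u" ..
  then show thesis by (intro that[of K]) simp
qed

lemma restrict_in_bounded_ops: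
  assumes "bounded_linear T" "subspace X" "\<And>x. x \<in> X \<Longrightarrow> T x \<in> Y"
  shows "restrict T X \<in> bounded_ops X Y"
proof -
  interpret bounded_linear T by fact
  have "\<exists>K. \<forall>u\<in>X. norm (restrict T X u) \<le> K * norm u"
    using bounded by (metis mult.commute restrict_apply')
  then show ?thesis
    using assms(2,3) by (auto simp: bounded_ops_def add scale subspace_add subspace_scale)
qed

text \<open>Composition with a projection turns an operator on the subspace into one on the whole
  space, where the ordinary theory of bounded linear maps and derivatives applies.\<close>

lemma bounded_ops_compose:
  fixes P :: "'c::real_normed_vector \<Rightarrow>\<^sub>L 'a::real_normed_vector"
  assumes T: "T \<in> bounded_ops X Y" and P: "range (blinfun_apply P) \<subseteq> X"
  shows "bounded_linear (\<lambda>z. T (P z))"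
proof -
  have PX: "P z \<in> X" for z using P by blast
  obtain K where K: "\<And>u. u \<in> X \<Longrightarrow> norm (T u) \<le> K * norm u"
    by (rule bounded_ops_bound[OF T]) blast
  show ?thesis
  proof (rule bounded_linear_intro)
    fix z
    have "norm (T (P z)) \<le> K * norm (P z)" by (rule K[OF PX])
    \<comment> \<open>The absolute value matters because \<open>K\<close> may be negative if
      \<open>X\<close> contains no nonzero vector.\<close>
    also have "\<dots> \<le> \<bar>K\<bar> * norm (P z)" by (simp add: mult_right_mono)
    also have "\<dots> \<le> \<bar>K\<bar> * (norm P * norm z)" by (intro mult_left_mono norm_blinfun) simp
    finally show "norm (T (P z)) \<le> norm z * (\<bar>K\<bar> * norm P)" by (simp add: mult_ac)
  qed (simp_all add: blinfun.bilinear_simps bounded_opsD[OF T PX] PX)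
qed

text \<open>The supremum in \<open>onorm_sub\<close> is taken in the reals, so it is an upper bound
  only once the quotients are known to be bounded.\<close>

lemma bdd_above_onorm_sub:
  assumes "T \<in> bounded_ops X Y" "S \<in> bounded_ops X Y"
  shows "bdd_above ((\<lambda>u. norm (T u - S u) / norm u) ` X)"
proof -
  obtain K L where K: "\<And>u. u \<in> X \<Longrightarrow> norm (T u) \<le> K * norm u"
    and L: "\<And>u. u \<in> X \<Longrightarrow> norm (S u) \<le> L * norm u"
    using bounded_ops_bound[OF assms(1)] bounded_ops_bound[OF assms(2)] by metis
  have "norm (T u - S u) / norm u \<le> \<bar>K\<bar> + \<bar>L\<bar>" if "u \<in> X" for u
  proof (cases "u = 0")
    case False
    have "norm (T u - S u) \<le> K * norm u + L * norm u"
      using norm_triangle_ineq4[of "T u" "S u"] K[OF that] L[OF that] by linarith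
    also have "\<dots> \<le> (\<bar>K\<bar> + \<bar>L\<bar>) * norm u"
      by (simp add: distrib_right add_mono mult_right_mono)
    finally show ?thesis using False by (simp add: divide_le_eq)
  qed simp
  then show ?thesis by (rule bdd_aboveI2)
qed

lemma onorm_sub_nonneg:
  fixes X :: "'a::real_normed_vector set"
  assumes "T \<in> bounded_ops X Y" "S \<in> bounded_ops X Y" "subspace X"
  shows "0 \<le> onorm_sub X (\<lambda>e. T e - S e)"
proof -
  \<comment> \<open>Division by zero yields zero, so the quotient at the zero vector contributes the
    value 0 to the supremum.\<close>
  have "norm (T 0 - S 0) / norm (0 :: 'a) \<le> onorm_sub X (\<lambda>e. T e - S e)"
    unfolding onorm_sub_def
    by (rule cSUP_upper[OF subspace_0[OF assms(3)] bdd_above_onorm_sub[OF assms(1,2)]])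
  then show ?thesis by simp
qed

lemma onorm_sub:
  assumes "T \<in> bounded_ops X Y" "S \<in> bounded_ops X Y" "u \<in> X"
  shows "norm (T u - S u) \<le> onorm_sub X (\<lambda>e. T e - S e) * norm u"
proof (cases "u = 0")
  case True
  then show ?thesis
    using bounded_opsD(3)[OF assms(1,3), of 0] bounded_opsD(3)[OF assms(2,3), of 0] by simp
next
  case False
  have "norm (T u - S u) / norm u \<le> onorm_sub X (\<lambda>e. T e - S e)"
    unfolding onorm_sub_def by (rule cSUP_upper[OF assms(3) bdd_above_onorm_sub[OF assms(1,2)]])
  then show ?thesis using False by (simp add: divide_le_eq)
qed

lemma op_continuous_on_cong:
  assumes "V = W" "\<And>x. x \<in> W \<Longrightarrow> T x = S x"
  shows "op_continuous_on V X T \<longleftrightarrow> op_continuous_on W X S"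
  using assms unfolding op_continuous_on_def by (intro ball_cong Lim_cong_within) auto

text \<open>Restricting operators to a subspace does not increase the norm of their difference, so
  norm continuity passes to \<open>onorm_sub\<close>.\<close>

lemma op_continuous_on_restrict:
  fixes T :: "'a::real_normed_vector \<Rightarrow> 'a \<Rightarrow>\<^sub>L 'b::real_normed_vector"
  assumes "continuous_on V T" "subspace X" "\<And>x e. x \<in> V \<Longrightarrow> e \<in> X \<Longrightarrow> T x e \<in> Y"
  shows "op_continuous_on V X (\<lambda>x. restrict (T x) X)"
  unfolding op_continuous_on_def
proof
  fix x assume x: "x \<in> V"
  have mem: "restrict (T y) X \<in> bounded_ops X Y" if "y \<in> V" for y
    using assms that by (intro restrict_in_bounded_ops blinfun.bounded_linear_right)
  have le: "onorm_sub X (\<lambda>e. restrict (T y) X e - restrict (T x) X e) \<le> norm (T y - T x)" for y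
    unfolding onorm_sub_def
  proof (rule cSUP_least)
    show "X \<noteq> {}" using subspace_0[OF assms(2)] by blast
    fix u assume u: "u \<in> X"
    have "norm (T y u - T x u) \<le> norm (T y - T x) * norm u"
      using norm_blinfun[of "T y - T x" u] by (simp add: blinfun.bilinear_simps)
    then have "norm (T y u - T x u) / norm u \<le> norm (T y - T x)"
      by (cases "u = 0") (simp_all add: divide_le_eq)
    then show "norm (restrict (T y) X u - restrict (T x) X u) / norm u \<le> norm (T y - T x)"
      using u by simp
  qed
  have "((\<lambda>y. norm (T y - T x)) \<longlongrightarrow> 0) (at x within V)"
    using assms(1) x by (simp add: continuous_on tendsto_norm_zero_iff LIM_zero_iff)
  moreover have "eventually (\<lambda>y. norm (onorm_sub X (\<lambda>e. restrict (T y) X e - restrict (T x) X e)) \<le> norm (T y - T x)) (at x within V)"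
    unfolding eventually_at_filter
    using onorm_sub_nonneg[OF mem mem[OF x] assms(2)] le by (intro always_eventually) auto
  ultimately show "((\<lambda>y. onorm_sub X (\<lambda>e. restrict (T y) X e - restrict (T x) X e)) \<longlongrightarrow> 0) (at x within V)"
    by (rule Lim_null_comparison[rotated])
qed

text \<open>The transfer opposite to \<open>op_continuous_on_restrict\<close>: composing with
  \<open>P\<close> enlarges the norm of a difference by a factor of at most
  \<open>norm P\<close>.\<close>

lemma continuous_on_compose_projection:
  fixes P :: "'c::real_normed_vector \<Rightarrow>\<^sub>L 'a::real_normed_vector"
    and T :: "'a \<Rightarrow> 'a \<Rightarrow> 'b::real_normed_vector"
  assumes cont: "op_continuous_on V X T" and T: "\<And>x. x \<in> V \<Longrightarrow> T x \<in> bounded_ops X Y"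
    and X: "subspace X" and P: "range (blinfun_apply P) \<subseteq> X"
  shows "continuous_on V (\<lambda>x. Blinfun (\<lambda>z. T x (P z)))"
  unfolding continuous_on
proof
  fix x assume x: "x \<in> V"
  let ?B = "\<lambda>x. Blinfun (\<lambda>z. T x (P z))"
  let ?n = "\<lambda>y. onorm_sub X (\<lambda>e. T y e - T x e)"
  have "norm (?B y - ?B x) \<le> ?n y * norm P" if y: "y \<in> V" for y
  proof (rule norm_blinfun_bound)
    have n: "0 \<le> ?n y" by (rule onorm_sub_nonneg[OF T[OF y] T[OF x] X])
    then show "0 \<le> ?n y * norm P" by simp
    fix z
    have "norm ((?B y - ?B x) z) = norm (T y (P z) - T x (P z))"
      using bounded_linear_Blinfun_apply[OF bounded_ops_compose[OF T P]] x y
      by (simp add: blinfun.bilinear_simps)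
    also have "\<dots> \<le> ?n y * norm (P z)"
      using P by (intro onorm_sub[OF T[OF y] T[OF x]]) auto
    also have "\<dots> \<le> ?n y * (norm P * norm z)"
      using n by (intro mult_left_mono norm_blinfun)
    finally show "norm ((?B y - ?B x) z) \<le> ?n y * norm P * norm z" by (simp add: mult_ac)
  qed
  then have "eventually (\<lambda>y. norm (?B y - ?B x) \<le> ?n y * norm P) (at x within V)"
    unfolding eventually_at_filter by (intro always_eventually) auto
  moreover have "((\<lambda>y. ?n y * norm P) \<longlongrightarrow> 0) (at x within V)"
    using cont x unfolding op_continuous_on_def by (intro tendsto_mult_left_zero) blast
  ultimately have "((\<lambda>y. ?B y - ?B x) \<longlongrightarrow> 0) (at x within V)"
    by (rule Lim_null_comparison)
  then show "(?B \<longlongrightarrow> ?B x) (at x within V)" by (simp add: LIM_zero_iff)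
qed

lemma has_frechet_derivative_sub_restrict:
  assumes h: "(h has_derivative L) (at x)" and X: "subspace X" "V \<subseteq> X" "x \<in> V"
    and L: "\<And>e. e \<in> X \<Longrightarrow> L e \<in> Y"
  shows "has_frechet_derivative_sub X Y V h (restrict L X) x"
proof -
  have "((\<lambda>y. norm (h y - h x - L (y - x)) / norm (y - x)) \<longlongrightarrow> 0) (at x within V)"
    using has_derivative_at_withinI[OF h, of V] by (simp add: has_derivative_iff_norm)
  moreover have "eventually (\<lambda>y. norm (h y - h x - L (y - x)) / norm (y - x)
      = norm (h y - h x - restrict L X (y - x)) / norm (y - x)) (at x within V)"
    unfolding eventually_at_filter using X by (intro always_eventually) (auto intro!: subspace_diff)
  ultimately have "((\<lambda>y. norm (h y - h x - restrict L X (y - x)) / norm (y - x)) \<longlongrightarrow> 0) (at x within V)"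
    by (rule Lim_transform_eventually)
  then show ?thesis
    unfolding has_frechet_derivative_sub_def
    using restrict_in_bounded_ops[OF has_derivative_bounded_linear[OF h] X(1) L] by blast
qed

text \<open>Differentiability passes from the subspace to the ambient space. The difference quotient
  of the composition at \<open>y\<close> is at most \<open>norm P\<close> times the quotient of
  \<open>f\<close> at \<open>P y\<close>, and the latter tends to zero by continuity of
  \<open>P\<close>.\<close>

lemma has_derivative_compose_projection:
  fixes P :: "'c::real_normed_vector \<Rightarrow>\<^sub>L 'a::real_normed_vector"
  assumes f: "has_frechet_derivative_sub X Y V f A (P z)"
    and P: "range (blinfun_apply P) \<subseteq> X" and W: "open W" "z \<in> W" "\<And>y. y \<in> W \<Longrightarrow> P y \<in> V"
  shows "((\<lambda>y. f (P y)) has_derivative (\<lambda>y. A (P y))) (at z)"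
proof -
  have A: "A \<in> bounded_ops X Y" using f by (simp add: has_frechet_derivative_sub_def)
  have lin: "bounded_linear (\<lambda>y. A (P y))" by (rule bounded_ops_compose[OF A P])
  \<comment> \<open>$q$ vanishes at the base point because division by zero yields zero, so it is continuous
    there even if $P$ takes the value $P z$ at other points.\<close>
  define q where "q y = norm (f y - f (P z) - A (y - P z)) / norm (y - P z)" for y
  have "(q \<longlongrightarrow> 0) (at (P z) within V)"
    using f unfolding has_frechet_derivative_sub_def q_def by blast
  then have "continuous (at (P z) within V) q"
    by (simp add: continuous_within q_def[of "P z"])
  then have "continuous (at (P z) within blinfun_apply P ` W) q"
    by (rule continuous_within_subset) (use W in blast)
  then have "continuous (at z within W) (q \<circ> blinfun_apply P)"
    by (intro continuous_within_compose continuous_intros)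
  then have "((\<lambda>y. q (P y)) \<longlongrightarrow> q (P z)) (at z)"
    unfolding continuous_within at_within_open[OF W(2,1)] comp_def .
  then have "((\<lambda>y. q (P y)) \<longlongrightarrow> 0) (at z)"
    by (simp add: q_def[of "P z"])
  then have lim: "((\<lambda>y. q (P y) * norm P) \<longlongrightarrow> 0) (at z)"
    by (rule tendsto_mult_left_zero)
  have "norm (norm (f (P y) - f (P z) - A (P (y - z))) / norm (y - z)) \<le> q (P y) * norm P" for y
  proof (cases "P y = P z")
    case True
    moreover have "A 0 = 0" using linear_0[OF bounded_linear.linear[OF lin]] by simp
    ultimately show ?thesis by (simp add: q_def blinfun.diff_right)
  next
    case False
    then have "y \<noteq> z" by blast
    have "norm (f (P y) - f (P z) - A (P (y - z))) = q (P y) * norm (P (y - z))"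
      using False by (simp add: q_def blinfun.diff_right)
    also have "\<dots> \<le> q (P y) * (norm P * norm (y - z))"
      by (intro mult_left_mono norm_blinfun) (simp add: q_def)
    finally show ?thesis using \<open>y \<noteq> z\<close> by (simp add: divide_le_eq mult_ac)
  qed
  then have "((\<lambda>y. norm (f (P y) - f (P z) - A (P (y - z))) / norm (y - z)) \<longlongrightarrow> 0) (at z)"
    by (intro Lim_null_comparison[OF _ lim] always_eventually) blast
  then show ?thesis using lin by (simp add: has_derivative_iff_norm)
qed

section \<open>Complements of a fixed subspace as graphs of bounded operators\<close>

lemma direct_sum_graph:
  fixes N :: "'a::banach set"
  assumes "direct_sum X Y" "direct_sum N Y"
  obtains T where "T \<in> bounded_ops X Y" "N = {e + T e | e. e \<in> X}"
proof -
  have sub: "subspace X" "subspace Y" using assms(1) by (auto simp: direct_sum_def)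
  obtain P :: "'a \<Rightarrow>\<^sub>L 'a" where P: "P o\<^sub>L P = P" "range (blinfun_apply P) = X" "{z. blinfun_apply P z = 0} = Y"
    using direct_sum_projection[OF assms(1)] .
  obtain R :: "'a \<Rightarrow>\<^sub>L 'a" where R: "R o\<^sub>L R = R" "range (blinfun_apply R) = N" "{z. blinfun_apply R z = 0} = Y"
    using direct_sum_projection[OF assms(2)] .
  have PP: "P (P z) = P z" and RR: "R (R z) = R z" for z
    using P(1) R(1) by (metis blinfun_apply_blinfun_compose)+
  have Y: "P z = 0 \<longleftrightarrow> z \<in> Y" "R z = 0 \<longleftrightarrow> z \<in> Y" for z using P(3) R(3) by blast+
  \<comment> \<open>The projections \<open>P\<close> and \<open>R\<close> share the kernel
    \<open>Y\<close>. Hence \<open>R\<close> moves a vector only by an element of \<open>Y\<close>,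
    and \<open>R\<close> restricted to \<open>X\<close> is the parametrisation of \<open>N\<close>
    as a graph.\<close>
  let ?T = "restrict (R - id_blinfun) X"
  have "?T \<in> bounded_ops X Y"
    by (intro restrict_in_bounded_ops blinfun.bounded_linear_right sub)
      (simp add: Y(2)[symmetric] blinfun.bilinear_simps RR)
  moreover have "N = {e + ?T e | e. e \<in> X}"
  proof safe
    fix n assume "n \<in> N"
    then have n: "R n = n" using R(2) RR by auto
    have "n - P n \<in> Y" unfolding Y(1)[symmetric] by (simp add: blinfun.bilinear_simps PP)
    then have "R (n - P n) = 0" unfolding Y(2) .
    then have "n = P n + ?T (P n)" using P(2) n by (auto simp: blinfun.bilinear_simps)
    then show "\<exists>e. n = e + ?T e \<and> e \<in> X" using P(2) by blast
  next
    fix e assume "e \<in> X"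
    then have "e + ?T e = R e" by (simp add: blinfun.bilinear_simps)
    then show "e + ?T e \<in> N" using R(2) by auto
  qed
  ultimately show ?thesis by (rule that)
qed

text \<open>The map sending \<open>z\<close> to \<open>P z + T (P z)\<close> is a bounded projection
  onto the graph, and its kernel is that of \<open>P\<close>.\<close>

lemma graph_direct_sum:
  fixes X :: "'a::banach set"
  assumes ds: "direct_sum X Y" and T: "T \<in> bounded_ops X Y"
  shows "direct_sum {e + T e | e. e \<in> X} Y"
proof -
  have sub: "subspace X" using ds by (auto simp: direct_sum_def)
  obtain P :: "'a \<Rightarrow>\<^sub>L 'a" where P: "P o\<^sub>L P = P" "range (blinfun_apply P) = X" "{z. blinfun_apply P z = 0} = Y"
    using direct_sum_projection[OF ds] .
  have PP: "P (P z) = P z" for z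
    using P(1) by (metis blinfun_apply_blinfun_compose)
  have PX: "P z \<in> X" for z using P(2) by blast
  have Y: "P z = 0 \<longleftrightarrow> z \<in> Y" for z using P(3) by blast
  have PT: "P (T (P z)) = 0" for z using Y bounded_opsD(1)[OF T PX] by blast
  have PX_id: "P e = e" if "e \<in> X" for e using that P(2) PP by auto
  have lin: "bounded_linear (\<lambda>z. T (P z))" by (rule bounded_ops_compose[OF T]) (simp add: P)
  have T0: "T 0 = 0" using linear_0[OF bounded_linear.linear[OF lin]] by simp
  define R where "R = P + Blinfun (\<lambda>z. T (P z))"
  have R: "R z = P z + T (P z)" for z
    by (simp add: R_def blinfun.bilinear_simps bounded_linear_Blinfun_apply[OF lin])
  have PR: "P (R z) = P z" for z by (simp add: R blinfun.bilinear_simps PP PT)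
  show ?thesis
  proof (rule direct_sumI_projection)
    show "R o\<^sub>L R = R" by (rule blinfun_eqI) (simp add: R[of "R _"] PR, simp add: R)
    show "range (blinfun_apply R) = {e + T e | e. e \<in> X}"
    proof safe
      fix z show "\<exists>e. R z = e + T e \<and> e \<in> X" using R PX by blast
    next
      fix e assume "e \<in> X"
      then have "e + T e = R e" by (simp add: R PX_id)
      then show "e + T e \<in> range (blinfun_apply R)" by blast
    qed
    have "R z = 0 \<longleftrightarrow> P z = 0" for z using PR[of z] by (auto simp: R T0)
    then show "{z. blinfun_apply R z = 0} = Y" using P(3) by blast
  qed
qed

section \<open>Integral submanifolds as graphs\<close>

text \<open>The integral manifold is the whole graph of \<open>\<psi>\<close> over \<open>V\<close>.
  A single chart, the shear on the preimage of \<open>V\<close> under \<open>P\<close>, serves all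
  of its points.\<close>

lemma integrable_at_if_graph:
  fixes \<Lambda> :: "'a::banach set" and M :: "'a \<Rightarrow> 'a set"
  assumes ds: "direct_sum X Y" and V: "openin (top_of_set X) V" "proj X Y x0 \<in> V"
    and \<psi>: "\<psi> ` V \<subseteq> Y" "\<psi> (proj X Y x0) = proj Y X x0"
    and cof: "\<And>x. x \<in> V \<Longrightarrow> x + \<psi> x \<in> cofinal_set \<Lambda> M Y"
    and cont: "op_continuous_on V X (\<lambda>x. coord_op X Y M (x + \<psi> x))"
    and der: "\<And>x. x \<in> V \<Longrightarrow> has_frechet_derivative_sub X Y V \<psi> (coord_op X Y M (x + \<psi> x)) x"
  shows "C1_integrable_at \<Lambda> M x0"
proof -
  have sub: "subspace X" "closed X" using ds by (auto simp: direct_sum_def)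
  obtain P :: "'a \<Rightarrow>\<^sub>L 'a" where P: "P o\<^sub>L P = P" "range (blinfun_apply P) = X" "{z. blinfun_apply P z = 0} = Y"
    using direct_sum_projection[OF ds] .
  have PP: "P (P z) = P z" for z using P(1) by (metis blinfun_apply_blinfun_compose)
  have PX: "P z \<in> X" for z using P(2) by blast
  have PX_id: "P e = e" if "e \<in> X" for e using that P(2) PP by auto
  have PY: "P e = 0" if "e \<in> Y" for e using that P(3) by blast
  have proj_XY: "proj X Y = P" by (rule proj_eqI[OF P])
  have proj_YX: "proj Y X = id_blinfun - P"
  proof (rule proj_eqI)
    show "(id_blinfun - P) o\<^sub>L (id_blinfun - P) = id_blinfun - P"
      by (rule blinfun_eqI) (simp add: blinfun.bilinear_simps PP)
    show "range (blinfun_apply (id_blinfun - P)) = Y"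
    proof safe
      fix z show "(id_blinfun - P) z \<in> Y" using P(3) PP by (auto simp: blinfun.bilinear_simps)
    next
      fix e assume "e \<in> Y"
      then have "e = (id_blinfun - P) e" by (simp add: blinfun.bilinear_simps PY)
      then show "e \<in> range (blinfun_apply (id_blinfun - P))" by blast
    qed
    show "{z. blinfun_apply (id_blinfun - P) z = 0} = X"
    proof safe
      fix z assume "(id_blinfun - P) z = 0"
      then have "z = P z" by (simp add: blinfun.bilinear_simps)
      then show "z \<in> X" using PX by metis
    qed (simp add: blinfun.bilinear_simps PX_id)
  qed
  have VX: "V \<subseteq> X" using V(1) by (rule openin_imp_subset)
  obtain O' where O': "open O'" "V = X \<inter> O'" using V(1) by (auto simp: openin_open)
  define W where "W = blinfun_apply P -` O'"
  have openW: "open W" unfolding W_def by (intro open_vimage O' continuous_intros)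
  have W: "z \<in> W \<longleftrightarrow> P z \<in> V" for z using O' PX by (auto simp: W_def)
  have \<psi>Y: "\<psi> x \<in> Y" if "x \<in> V" for x using \<psi>(1) that by blast
  define \<alpha> where "\<alpha> x = coord_op X Y M (x + \<psi> x)" for x
  have \<alpha>: "\<alpha> x \<in> bounded_ops X Y" "M (x + \<psi> x) = {e + \<alpha> x e | e. e \<in> X}" if "x \<in> V" for x
  proof -
    have "direct_sum (M (x + \<psi> x)) Y" using cof[OF that] by (simp add: cofinal_set_def)
    then obtain T where T: "T \<in> bounded_ops X Y" "M (x + \<psi> x) = {e + T e | e. e \<in> X}"
      using direct_sum_graph[OF ds] by blast
    then have "\<alpha> x = T" unfolding \<alpha>_def by (rule coord_op_eqI[OF ds])
    then show "\<alpha> x \<in> bounded_ops X Y" "M (x + \<psi> x) = {e + \<alpha> x e | e. e \<in> X}" using T by auto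
  qed
  have P_range: "range (blinfun_apply P) \<subseteq> X" using P(2) by simp
  \<comment> \<open>\<open>T x\<close> extends \<open>\<alpha> x\<close> by zero on
    \<open>Y\<close>, which makes it an operator on the whole space.\<close>
  define T where "T x = Blinfun (\<lambda>z. \<alpha> x (P z))" for x
  have T: "blinfun_apply (T x) = (\<lambda>z. \<alpha> x (P z))" if "x \<in> V" for x
    unfolding T_def by (rule bounded_linear_Blinfun_apply[OF bounded_ops_compose[OF \<alpha>(1)[OF that] P_range]])
  have contT: "continuous_on V T"
    unfolding T_def by (rule continuous_on_compose_projection[OF cont[folded \<alpha>_def] \<alpha>(1) sub(1) P_range])
  have contTP: "continuous_on W (\<lambda>z. T (P z))"
    by (rule continuous_on_compose2[OF contT]) (auto intro!: continuous_intros simp: W)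
  have d\<psi>: "((\<lambda>z. \<psi> (P z)) has_derivative blinfun_apply (T (P z))) (at z)" if "z \<in> W" for z
    unfolding T[OF that[unfolded W]] \<alpha>_def
    by (rule has_derivative_compose_projection[OF der P_range openW that]) (use that W in auto)
  \<comment> \<open>Both shears leave the component along \<open>X\<close> unchanged, so they undo
    each other and map \<open>W\<close> onto itself. The derivative of the inverse is therefore
    explicit.\<close>
  define f where "f z = z - \<psi> (P z)" for z
  define g where "g z = z + \<psi> (P z)" for z
  define S where "S = (\<lambda>x. x + \<psi> x) ` V"
  have P\<psi>: "P (\<psi> x) = 0" if "x \<in> V" for x using PY \<psi>Y that by blast
  have Pf: "P (f z) = P z" and Pg: "P (g z) = P z" if "z \<in> W" for z
    using that by (simp_all add: f_def g_def blinfun.bilinear_simps P\<psi> W)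
  have gf: "g (f z) = z" and fg: "f (g z) = z" if "z \<in> W" for z
    using Pf[OF that] Pg[OF that] by (simp_all add: f_def g_def)
  have fW: "f ` W = W"
  proof
    show "f ` W \<subseteq> W" using Pf W by auto
    show "W \<subseteq> f ` W"
    proof
      fix z assume z: "z \<in> W"
      then have "g z \<in> W" using Pg W by simp
      then show "z \<in> f ` W" using fg[OF z] by (metis imageI)
    qed
  qed
  have df: "(f has_derivative blinfun_apply (id_blinfun - T (P z))) (at z)" if "z \<in> W" for z
    unfolding f_def using has_derivative_diff[OF has_derivative_ident d\<psi>[OF that]]
    by (simp add: minus_blinfun.rep_eq)
  have dg: "(g has_derivative blinfun_apply (id_blinfun + T (P z))) (at z)" if "z \<in> W" for z
    unfolding g_def using has_derivative_add[OF has_derivative_ident d\<psi>[OF that]]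
    by (simp add: plus_blinfun.rep_eq)
  have diffeo: "C1_diffeomorphism_on W f"
    by (rule C1_diffeomorphism_onI[where g = g and f' = "\<lambda>z. id_blinfun - T (P z)" and g' = "\<lambda>z. id_blinfun + T (P z)"])
      (use openW gf df dg contTP in \<open>auto simp: fW intro!: continuous_intros\<close>)
  have P_graph: "P (x + \<psi> x) = x" if "x \<in> V" for x
    using that VX P\<psi> by (simp add: blinfun.bilinear_simps PX_id subset_iff)
  have SW: "S \<subseteq> W" using P_graph W by (auto simp: S_def)
  have fS: "f ` (S \<inter> W) = V"
  proof -
    have "f ` (S \<inter> W) = (\<lambda>x. f (x + \<psi> x)) ` V" using SW by (simp add: Int_absorb2 S_def image_image)
    also have "\<dots> = (\<lambda>x. x) ` V" by (rule image_cong) (simp_all add: f_def P_graph)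
    finally show ?thesis by simp
  qed
  have "C1_submanifold S"
    unfolding C1_submanifold_def
  proof
    fix p assume "p \<in> S"
    then show "\<exists>E0 U0 (\<phi> :: 'a \<Rightarrow> 'a). splits E0 \<and> open U0 \<and> p \<in> U0 \<and> C1_diffeomorphism_on U0 \<phi> \<and>
        openin (top_of_set E0) (\<phi> ` (S \<inter> U0))"
      using ds openW SW diffeo V(1) fS unfolding splits_def by (intro exI[of _ X] exI[of _ W] exI[of _ f]) auto
  qed
  moreover have "tangent_to S (M p) p" if "p \<in> S" for p
  proof -
    obtain x where x: "x \<in> V" "p = x + \<psi> x" using \<open>p \<in> S\<close> by (auto simp: S_def)
    have pW: "p \<in> W" using that SW by blast
    have Pp: "P p = x" using P_graph x by simp
    \<comment> \<open>Subtracting \<open>\<alpha> x (P u)\<close> changes only the component of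
      \<open>u\<close> along \<open>Y\<close>. The result lies in \<open>X\<close> exactly when that
      component equals \<open>\<alpha> x (P u)\<close>, that is, when \<open>u\<close> lies on the
      graph of \<open>\<alpha> x\<close>.\<close>
    have "M p = {u. (id_blinfun - T (P p)) u \<in> X}"
    proof -
      have "u \<in> M p \<longleftrightarrow> u - \<alpha> x (P u) \<in> X" for u
      proof
        assume "u \<in> M p"
        then obtain e where e: "e \<in> X" "u = e + \<alpha> x e" using \<alpha>(2) x by auto
        then have "P u = e"
          using bounded_opsD(1)[OF \<alpha>(1)[OF x(1)] e(1)] by (simp add: blinfun.bilinear_simps PX_id PY)
        then show "u - \<alpha> x (P u) \<in> X" using e by simp
      next
        assume m: "u - \<alpha> x (P u) \<in> X"
        have "P (\<alpha> x (P u)) = 0" using bounded_opsD(1)[OF \<alpha>(1)[OF x(1)] PX] by (rule PY)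
        then have "P u = u - \<alpha> x (P u)" using PX_id[OF m] by (simp add: blinfun.bilinear_simps)
        then have "u = P u + \<alpha> x (P u)" by (simp add: algebra_simps)
        then show "u \<in> M p" unfolding x(2) \<alpha>(2)[OF x(1)] using PX by blast
      qed
      then show ?thesis using x(1) by (auto simp: blinfun.bilinear_simps Pp T)
    qed
    then show ?thesis
      using tangent_to_chart[OF diffeo sub _ that pW df[OF pW]] V(1) fS by simp
  qed
  moreover have "S \<subseteq> \<Lambda>" using cof by (auto simp: S_def cofinal_set_def)
  moreover have "x0 \<in> S"
  proof -
    have "x0 = P x0 + \<psi> (P x0)"
      using \<psi>(2) by (simp add: proj_XY proj_YX blinfun.bilinear_simps)
    then show ?thesis using V(2) by (auto simp: S_def proj_XY)
  qed
  ultimately show ?thesis unfolding C1_integrable_at_def by blast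
qed

text \<open>The complement \<open>Y\<close> is the preimage of \<open>E1\<close> under the
  derivative of the chart at \<open>x0\<close>. The domain \<open>V\<close> is the part of the image
  of \<open>F\<close> in \<open>X\<close>, and \<open>\<psi>\<close> is the component along
  \<open>Y\<close> of the local inverse \<open>G\<close>.\<close>

lemma graph_if_integrable_at:
  fixes \<Lambda> :: "'a::banach set" and M :: "'a \<Rightarrow> 'a set"
  assumes int: "C1_integrable_at \<Lambda> M x0"
  obtains Y V \<psi> where "direct_sum (M x0) Y" "openin (top_of_set (M x0)) V" "proj (M x0) Y x0 \<in> V"
    "C1_map_sub (M x0) Y V \<psi>"
    "\<And>x. x \<in> V \<Longrightarrow> x + \<psi> x \<in> cofinal_set \<Lambda> M Y"
    "op_continuous_on V (M x0) (\<lambda>x. coord_op (M x0) Y M (x + \<psi> x))"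
    "\<And>x. x \<in> V \<Longrightarrow> has_frechet_derivative_sub (M x0) Y V \<psi> (coord_op (M x0) Y M (x + \<psi> x)) x"
    "\<psi> (proj (M x0) Y x0) = proj Y (M x0) x0"
proof -
  obtain S where S: "S \<subseteq> \<Lambda>" "C1_submanifold S" "x0 \<in> S" "\<And>x. x \<in> S \<Longrightarrow> tangent_to S (M x) x"
    using int unfolding C1_integrable_at_def by blast
  obtain E0 U0 and \<phi> :: "'a \<Rightarrow> 'a" where E0: "splits E0" and U0: "open U0" "x0 \<in> U0"
    and diff\<phi>: "C1_diffeomorphism_on U0 \<phi>" and op\<phi>: "openin (top_of_set E0) (\<phi> ` (S \<inter> U0))"
    using S(2,3) unfolding C1_submanifold_def by meson
  obtain E1 where E01: "direct_sum E0 E1" using E0 unfolding splits_def by blast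
  then have E0_sub: "subspace E0" "closed E0" by (auto simp: direct_sum_def)
  obtain P0 :: "'a \<Rightarrow>\<^sub>L 'a" where P0: "P0 o\<^sub>L P0 = P0" "range (blinfun_apply P0) = E0" "{z. blinfun_apply P0 z = 0} = E1"
    using direct_sum_projection[OF E01] .
  have P0P0: "P0 (P0 z) = P0 z" for z using P0(1) by (metis blinfun_apply_blinfun_compose)
  have P0E: "P0 z = z \<longleftrightarrow> z \<in> E0" for z using P0(2) P0P0 by (metis rangeE rangeI)
  obtain D gi gi' where gi: "\<And>x. x \<in> U0 \<Longrightarrow> gi (\<phi> x) = x"
    and d\<phi>: "\<And>x. x \<in> U0 \<Longrightarrow> (\<phi> has_derivative blinfun_apply (D x)) (at x)" "continuous_on U0 D"
    and inv\<phi>: "\<And>x. x \<in> U0 \<Longrightarrow> gi' (\<phi> x) o\<^sub>L D x = id_blinfun" "\<And>x. x \<in> U0 \<Longrightarrow> D x o\<^sub>L gi' (\<phi> x) = id_blinfun"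
    using diff\<phi> by (rule C1_diffeomorphism_onE) blast
  define A where "A = D x0"
  define B where "B = gi' (\<phi> x0)"
  have AB: "A (B z) = z" "B (A z) = z" for z
    using inv\<phi>[OF U0(2)] unfolding A_def B_def
    by (metis blinfun_apply_blinfun_compose blinfun_apply_id_blinfun id_apply)+
  define X where "X = {u. A u \<in> E0}"
  define Y where "Y = {u. A u \<in> E1}"
  \<comment> \<open>Tangency fixes the tangent set uniquely, so \<open>M x\<close> can be computed
    in any chart. This is applied to \<open>\<phi>\<close> at \<open>x0\<close> and to
    \<open>F\<close> at the points of the graph.\<close>
  have M_chart: "M x = {u. f' u \<in> E}"
    if "x \<in> S" "x \<in> U" "C1_diffeomorphism_on U f" "subspace E" "closed E"
      "openin (top_of_set E) (f ` (S \<inter> U))" "(f has_derivative f') (at x)" for x U E f f'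
    using S(4)[OF that(1)] tangent_to_chart[OF that(3-6,1,2,7)] unfolding tangent_to_def by simp
  have MX: "M x0 = X"
    unfolding X_def A_def by (rule M_chart[OF S(3) U0(2) diff\<phi> E0_sub op\<phi> d\<phi>(1)[OF U0(2)]])
  \<comment> \<open>Conjugating \<open>P0\<close> by the derivative of the chart gives the
    projection onto \<open>X\<close> along \<open>Y\<close>.\<close>
  define P where "P = B o\<^sub>L P0 o\<^sub>L A"
  define Q where "Q = id_blinfun - P"
  have P_apply: "P z = B (P0 (A z))" and Q_apply: "Q z = z - P z" for z
    by (simp_all add: P_def Q_def blinfun.bilinear_simps)
  have PP: "P (P z) = P z" for z by (simp add: P_apply AB P0P0)
  have PX: "P z = z \<longleftrightarrow> z \<in> X" for z
    unfolding X_def P_apply by (simp flip: P0E) (metis AB)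
  have "B w = 0 \<longleftrightarrow> w = 0" for w using AB(1)[of w] by auto
  then have PY: "P z = 0 \<longleftrightarrow> z \<in> Y" for z
    using P0(3) by (auto simp: Y_def P_apply)
  have PQ: "P (Q z) = 0" for z by (simp add: Q_apply blinfun.bilinear_simps PP)
  have QX: "Q z = 0 \<longleftrightarrow> z \<in> X" for z using PX[of z] by (auto simp: Q_apply)
  have QY: "Q z = z \<longleftrightarrow> z \<in> Y" for z using PY[of z] by (auto simp: Q_apply)
  have P: "P o\<^sub>L P = P" "range (blinfun_apply P) = X" "{z. blinfun_apply P z = 0} = Y"
  proof -
    show "P o\<^sub>L P = P" by (rule blinfun_eqI) (simp add: PP)
    show "range (blinfun_apply P) = X" using PX PP by (metis image_subsetI rangeI subsetI subset_antisym)
    show "{z. blinfun_apply P z = 0} = Y" using PY by blast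
  qed
  have Q: "Q o\<^sub>L Q = Q" "range (blinfun_apply Q) = Y" "{z. blinfun_apply Q z = 0} = X"
  proof -
    show "Q o\<^sub>L Q = Q" by (rule blinfun_eqI) (simp add: Q_apply[of "Q _"] PQ)
    show "range (blinfun_apply Q) = Y" using QY PQ PY by (metis image_subsetI rangeI subsetI subset_antisym)
    show "{z. blinfun_apply Q z = 0} = X" using QX by blast
  qed
  have ds: "direct_sum X Y" by (rule direct_sumI_projection[OF P])
  then have X: "subspace X" "closed X" by (auto simp: direct_sum_def)
  note proj = proj_eqI[OF P] proj_eqI[OF Q]
  obtain O' where O': "open O'" "\<phi> ` (S \<inter> U0) = E0 \<inter> O'" using op\<phi> by (auto simp: openin_open)
  have cont\<phi>: "continuous_on U0 \<phi>"
    using d\<phi>(1) has_derivative_continuous continuous_at_imp_continuous_on by blast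
  \<comment> \<open>On \<open>U0\<close> a point with \<open>\<phi> x\<close> in \<open>E0\<close>
    may lie outside \<open>S\<close>. Requiring \<open>\<phi> x\<close> in \<open>O'\<close> as well
    makes membership in \<open>S\<close> equivalent to an equation.\<close>
  define U where "U = U0 \<inter> \<phi> -` O'"
  have openU: "open U" unfolding U_def by (rule continuous_open_preimage[OF cont\<phi> U0(1) O'(1)])
  have inU: "x \<in> U" if "x \<in> S" "x \<in> U0" for x using that O'(2) by (auto simp: U_def)
  have S_iff: "x \<in> S \<longleftrightarrow> Q (B (\<phi> x)) = 0" if "x \<in> U" for x
  proof -
    have x: "x \<in> U0" "\<phi> x \<in> O'" using that by (auto simp: U_def)
    have "Q (B (\<phi> x)) = 0 \<longleftrightarrow> \<phi> x \<in> E0" unfolding QX by (simp add: X_def AB)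
    also have "\<dots> \<longleftrightarrow> \<phi> x \<in> \<phi> ` (S \<inter> U0)" using O' x by auto
    also have "\<dots> \<longleftrightarrow> x \<in> S"
    proof
      assume "\<phi> x \<in> \<phi> ` (S \<inter> U0)"
      then obtain y where y: "y \<in> S" "y \<in> U0" "\<phi> x = \<phi> y" by blast
      have "y = x" using gi[OF x(1)] unfolding y(3) gi[OF y(2)] .
      then show "x \<in> S" using y(1) by (rule subst)
    qed (use x(1) in blast)
    finally show ?thesis by simp
  qed
  \<comment> \<open>After the chart, only the component along $Y$ detects membership in $S$; replacing the
    component along $X$ by that of $z$ makes the local inverse of $F$ a graph over $X$.\<close>
  define F where "F z = P z + Q (B (\<phi> z))" for z
  define F' where "F' z = P + (Q o\<^sub>L B o\<^sub>L D z)" for z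
  have dF: "(F has_derivative blinfun_apply (F' z)) (at z)" if "z \<in> U" for z
  proof -
    have "z \<in> U0" using that by (simp add: U_def)
    then have "((\<lambda>z. P z + (Q o\<^sub>L B) (\<phi> z)) has_derivative (\<lambda>u. P u + (Q o\<^sub>L B) (D z u))) (at z)"
      by (intro has_derivative_add bounded_linear.has_derivative[OF blinfun.bounded_linear_right]
          has_derivative_ident d\<phi>(1))
    then show ?thesis
      by (simp add: F_def[abs_def] F'_def plus_blinfun.rep_eq blinfun_compose.rep_eq comp_def)
  qed
  have contF': "continuous_on U F'"
    unfolding F'_def
    by (intro continuous_intros continuous_on_subset[OF d\<phi>(2)]) (auto simp: U_def)
  \<comment> \<open>At \<open>x0\<close> the factor \<open>B\<close> cancels the derivative of the
    chart, leaving \<open>P + Q\<close>, which is the identity.\<close>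
  have "F' x0 = id_blinfun"
    by (rule blinfun_eqI) (simp add: F'_def A_def[symmetric] AB blinfun.bilinear_simps Q_apply)
  then obtain N G G' where N: "open N" "x0 \<in> N" "N \<subseteq> U" "open (F ` N)"
    and GF: "\<And>x. x \<in> N \<Longrightarrow> G (F x) = x"
    and dG: "\<And>y. y \<in> F ` N \<Longrightarrow> (G has_derivative blinfun_apply (G' y)) (at y)" "continuous_on (F ` N) G'"
    and inv: "\<And>x. x \<in> N \<Longrightarrow> F' x o\<^sub>L G' (F x) = id_blinfun" "\<And>x. x \<in> N \<Longrightarrow> G' (F x) o\<^sub>L F' x = id_blinfun"
    using local_inverse_near_identity[OF openU inU[OF S(3) U0(2)] dF contF'] by blast
  have dF_N: "(F has_derivative blinfun_apply (F' z)) (at z)" if "z \<in> N" for z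
    using dF N(3) that by blast
  have contF'_N: "continuous_on N F'" by (rule continuous_on_subset[OF contF' N(3)])
  \<comment> \<open>Thus \<open>F\<close> is a second chart of \<open>S\<close> near
    \<open>x0\<close>, with model space \<open>M x0\<close> itself.\<close>
  have diffF: "C1_diffeomorphism_on N F"
    by (rule C1_diffeomorphism_onI[OF N(1,4) GF dF_N contF'_N dG])
  have PF: "P (F z) = P z" and QF: "Q (F z) = Q (B (\<phi> z))" for z
    by (simp_all add: F_def blinfun.bilinear_simps PP PQ Q_apply)
  have FX: "F z \<in> X \<longleftrightarrow> z \<in> S" if "z \<in> N" for z
    using S_iff[of z] N(3) that QX[of "F z"] by (auto simp: QF)
  define V where "V = X \<inter> F ` N"
  have FS: "F ` (S \<inter> N) = V" using FX by (auto simp: V_def)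
  have V: "openin (top_of_set X) V" unfolding V_def using N(4) by (simp add: openin_open_Int)
  define \<psi> where "\<psi> v = Q (G v)" for v
  \<comment> \<open>\<open>F\<close> keeps the component along \<open>X\<close>, and
    \<open>v\<close> lies in \<open>X\<close>. So \<open>G v\<close> has component \<open>v\<close>
    along \<open>X\<close>, and \<open>\<psi> v\<close> is what remains.\<close>
  have graph: "G v \<in> N" "F (G v) = v" "G v \<in> S" "v + \<psi> v = G v" if v: "v \<in> V" for v
  proof -
    obtain z where z: "z \<in> S" "z \<in> N" "v = F z" using v FS by blast
    have "P z = v" using PF[of z] PX[of v] v z(3) by (simp add: V_def)
    then show "G v \<in> N" "F (G v) = v" "G v \<in> S" "v + \<psi> v = G v"
      using z by (simp_all add: GF \<psi>_def Q_apply)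
  qed
  define T where "T v = Q o\<^sub>L G' v" for v
  \<comment> \<open>Linearised, \<open>F\<close> still keeps the component along \<open>X\<close>,
    and so does its inverse. Hence \<open>G' v\<close> maps \<open>e\<close> in \<open>X\<close> to
    \<open>e + T v e\<close>, which is the graph form required of the coordinate operator.\<close>
  have PG': "P (G' v u) = P u" and FG': "F' (G v) (G' v u) = u" and G'F: "G' v (F' (G v) u) = u"
    if "v \<in> V" for v u
  proof -
    show FG: "F' (G v) (G' v u) = u" for u
      using inv(1)[OF graph(1)[OF that]] graph(2)[OF that]
      by (metis blinfun_apply_blinfun_compose blinfun_apply_id_blinfun id_apply)
    show "G' v (F' (G v) u) = u"
      using inv(2)[OF graph(1)[OF that]] graph(2)[OF that]
      by (metis blinfun_apply_blinfun_compose blinfun_apply_id_blinfun id_apply)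
    have "P (F' (G v) w) = P w" for w by (simp add: F'_def blinfun.bilinear_simps PP PQ)
    then show "P (G' v u) = P u" using FG by metis
  qed
  have TY: "T v u \<in> Y" for v u using PY PQ by (simp add: T_def)
  have T_ops: "restrict (T v) X \<in> bounded_ops X Y" for v
    by (intro restrict_in_bounded_ops blinfun.bounded_linear_right X TY)
  have M_graph: "M (v + \<psi> v) = {e + restrict (T v) X e | e. e \<in> X}" if v: "v \<in> V" for v
  proof -
    \<comment> \<open>The chart gives \<open>M (G v)\<close> as a preimage of \<open>X\<close> under
      \<open>F'\<close>; invertibility turns it into the image of \<open>X\<close> under
      \<open>G' v\<close>, and that image is a graph over \<open>X\<close>.\<close>
    have "M (G v) = {u. F' (G v) u \<in> X}"
      by (rule M_chart[OF graph(3,1)[OF v] diffF X _ dF_N[OF graph(1)[OF v]]]) (simp add: FS V)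
    also have "\<dots> = blinfun_apply (G' v) ` X"
    proof safe
      fix u assume "F' (G v) u \<in> X"
      then show "u \<in> blinfun_apply (G' v) ` X" using G'F[OF v, of u] by (metis imageI)
    qed (simp add: FG'[OF v])
    also have "\<dots> = {e + restrict (T v) X e | e. e \<in> X}"
    proof -
      have "G' v e = e + restrict (T v) X e" if "e \<in> X" for e
        using that PG'[OF v, of e] PX[of e] by (simp add: T_def Q_apply)
      then show ?thesis by (auto simp: image_iff)
    qed
    finally show ?thesis using graph(4)[OF v] by simp
  qed
  have coord: "coord_op X Y M (v + \<psi> v) = restrict (T v) X" if "v \<in> V" for v
    using ds T_ops M_graph[OF that] by (rule coord_op_eqI)
  have der: "has_frechet_derivative_sub X Y V \<psi> (restrict (T v) X) v" if "v \<in> V" for v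
  proof (rule has_frechet_derivative_sub_restrict)
    have "v \<in> F ` N" using that by (simp add: V_def)
    then show "(\<psi> has_derivative blinfun_apply (T v)) (at v)"
      unfolding \<psi>_def[abs_def] T_def blinfun_compose.rep_eq comp_def
      by (intro bounded_linear.has_derivative[OF blinfun.bounded_linear_right] dG(1))
  qed (use that X TY in \<open>auto simp: V_def\<close>)
  have contT: "op_continuous_on V X (\<lambda>v. restrict (T v) X)"
  proof (rule op_continuous_on_restrict[OF _ X(1) TY])
    show "continuous_on V T"
      unfolding T_def by (intro continuous_intros continuous_on_subset[OF dG(2)]) (auto simp: V_def)
  qed
  show thesis
  proof (rule that, unfold MX)
    show "direct_sum X Y" "openin (top_of_set X) V" by fact+
    \<comment> \<open>As \<open>x0\<close> is in \<open>S\<close>, its image lies in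
      \<open>X\<close> and so equals its own component along \<open>X\<close>, which is
      \<open>P x0\<close>. Applying \<open>G\<close> then yields the initial condition for
      \<open>\<psi>\<close>.\<close>
    have Fx0: "F x0 = P x0" using FX[OF N(2)] S(3) PX[of "F x0"] PF[of x0] by simp
    have "F x0 \<in> V" using FS S(3) N(2) by blast
    then show "proj X Y x0 \<in> V" by (simp add: proj Fx0)
    show "\<psi> (proj X Y x0) = proj Y X x0"
      using GF[OF N(2)] unfolding Fx0 by (simp add: proj \<psi>_def)
    show "x + \<psi> x \<in> cofinal_set \<Lambda> M Y" if "x \<in> V" for x
      using graph(3,4)[OF that] S(1) M_graph[OF that] graph_direct_sum[OF ds T_ops[of x]]
      by (auto simp: cofinal_set_def)
    show "has_frechet_derivative_sub X Y V \<psi> (coord_op X Y M (x + \<psi> x)) x" if "x \<in> V" for x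
      using der[OF that] by (simp add: coord[OF that])
    show "op_continuous_on V X (\<lambda>x. coord_op X Y M (x + \<psi> x))"
      using contT by (simp add: coord cong: op_continuous_on_cong)
    show "C1_map_sub X Y V \<psi>"
      unfolding C1_map_sub_def
    proof (intro conjI exI[of _ "\<lambda>v. restrict (T v) X"] ballI)
      show "\<psi> ` V \<subseteq> Y" using PY PQ by (auto simp: \<psi>_def)
    qed (use der contT in auto)
  qed
qed

theorem theorem2p3:
  fixes \<Lambda> :: "'a::banach set" and M :: "'a \<Rightarrow> 'a set" and x0 :: 'a and M0 :: "'a set"
  assumes "open \<Lambda>"
    and "\<And>x. x \<in> \<Lambda> \<Longrightarrow> subspace (M x)"
    and "x0 \<in> \<Lambda>"
    and "M0 = M x0"
  shows "C1_integrable_at \<Lambda> M x0 \<longleftrightarrow>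
    (\<exists>Es. direct_sum M0 Es \<and>
      (\<exists>V \<psi>.
         openin (top_of_set M0) V \<and> proj M0 Es x0 \<in> V \<and>
         C1_map_sub M0 Es V \<psi> \<and>
         (\<forall>x\<in>V. x + \<psi> x \<in> cofinal_set \<Lambda> M Es) \<and>
         op_continuous_on V M0 (\<lambda>x. coord_op M0 Es M (x + \<psi> x)) \<and>
         (\<forall>x\<in>V. has_frechet_derivative_sub M0 Es V \<psi> (coord_op M0 Es M (x + \<psi> x)) x) \<and>
         \<psi> (proj M0 Es x0) = proj Es M0 x0))"
  (is "_ \<longleftrightarrow> ?R")
proof
  assume "C1_integrable_at \<Lambda> M x0"
  then obtain Es V \<psi> where "direct_sum M0 Es" "openin (top_of_set M0) V" "proj M0 Es x0 \<in> V"
    "C1_map_sub M0 Es V \<psi>" "\<And>x. x \<in> V \<Longrightarrow> x + \<psi> x \<in> cofinal_set \<Lambda> M Es"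
    "op_continuous_on V M0 (\<lambda>x. coord_op M0 Es M (x + \<psi> x))"
    "\<And>x. x \<in> V \<Longrightarrow> has_frechet_derivative_sub M0 Es V \<psi> (coord_op M0 Es M (x + \<psi> x)) x"
    "\<psi> (proj M0 Es x0) = proj Es M0 x0"
    unfolding \<open>M0 = M x0\<close> by (rule graph_if_integrable_at) blast
  then show ?R by (intro exI[of _ Es] exI[of _ V] exI[of _ \<psi>] conjI ballI) auto
next
  assume ?R
  then obtain Es V \<psi> where "direct_sum M0 Es" "openin (top_of_set M0) V" "proj M0 Es x0 \<in> V"
    "C1_map_sub M0 Es V \<psi>" "\<forall>x\<in>V. x + \<psi> x \<in> cofinal_set \<Lambda> M Es"
    "op_continuous_on V M0 (\<lambda>x. coord_op M0 Es M (x + \<psi> x))"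
    "\<forall>x\<in>V. has_frechet_derivative_sub M0 Es V \<psi> (coord_op M0 Es M (x + \<psi> x)) x"
    "\<psi> (proj M0 Es x0) = proj Es M0 x0"
    by blast
  then show "C1_integrable_at \<Lambda> M x0"
    by (intro integrable_at_if_graph[of M0 Es V x0 \<psi>]) (auto simp: C1_map_sub_def)
qed

end
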